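(* Let $D$ be a compact metric space with metric $d$, $\lambda$ a Radon measure on $D$ and $\mu>0$. Then the FIFM matching process $\{\eta_t\}$ on $D$ (defined in the context) has a stationary distribution, and this stationary distribution is unique.
   Context: $\mathbf C=\{\mathtt R,\mathtt B\}$ (colors), $\bar{\mathtt R}=\mathtt B$, $\bar{\mathtt B}=\mathtt R$; $\bar\lambda=\lambda\otimes m_c$ on $D\times\mathbf C$ with $m_c$ counting measure on $\mathbf C$. For $x=(p_x,c_x)\in D\times\mathbf C$, $N(x)=\{y\in D\times\mathbf C:c_y=\bar c_x,\ d(p_x,p_y)<1\}$, $N(A)=\bigcup_{x\in A}N(x)$. FIFM matching process: the Markov jump process whose state is a finite ordered list $\eta=(x_1,\dots,x_n)$ of elements of $D\times\mathbf C$, with transitions: for each $i$, $x_i$ is removed (order of the others kept) at rate $\mu+\bar\lambda(W_{x_i})$, where $W_{x_i}=N(x_i)\setminus N(\{x_1,\dots,x_{i-1}\})$; and at rate $\bar\lambda(dx)\mathbf 1(x\notin N(\eta))$ the element $x$ is appended at the end of the list. (I.e. red and blue particles arrive as Poisson processes with intensity $\lambda$ per unit time; an arrival is matched with the earliest present particle of opposite color within distance less than $1$, and both disappear; otherwise it joins the end of the list; present particles also leave at rate $\mu$.) *)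

theory Defs
  imports "HOL-Probability.Probability"
begin

section \<open>Radon measures\<close>

definition radon_measure :: "'a::topological_space measure \<Rightarrow> bool" where
  "radon_measure M \<longleftrightarrow>
     sets M = sets borel \<and>
     (\<forall>x. \<exists>U. open U \<and> x \<in> U \<and> emeasure M U < \<infinity>) \<and>
     (\<forall>A\<in>sets borel. emeasure M A = (SUP K\<in>{K. compact K \<and> K \<subseteq> A}. emeasure M K))"


section \<open>Markov jump processes with a given rate kernel\<close>

text \<open>
  A rate kernel \<open>Q\<close> assigns to every state \<open>x\<close> a finite measure: the process sitting in \<open>x\<close>
  jumps into \<open>A\<close> at rate \<open>Q x A\<close>, so it stays in \<open>x\<close> for an exponential time with
  parameter \<open>total_rate Q x\<close> and then picks the next state from the normalisation of \<open>Q x\<close>.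
  \<open>jump_trans_upto Q n t x A\<close> is the probability that, started in \<open>x\<close>, the process
  has made fewer than \<open>n\<close> jumps by time \<open>t\<close> and is in \<open>A\<close> at time \<open>t\<close>; the recursion
  conditions on the first jump, which happens at time \<open>s\<close> into \<open>y\<close> with density
  \<open>exp (- total_rate Q x * s) ds Q x (dy)\<close>. The supremum over \<open>n\<close> is the transition function
  of the (minimal) jump process; total mass below 1 would mean explosion.
\<close>

definition total_rate :: "('s \<Rightarrow> 's measure) \<Rightarrow> 's \<Rightarrow> real" where
  "total_rate Q x = measure (Q x) (space (Q x))"

primrec jump_trans_upto ::
  "('s \<Rightarrow> 's measure) \<Rightarrow> nat \<Rightarrow> real \<Rightarrow> 's \<Rightarrow> 's set \<Rightarrow> ennreal" where
  "jump_trans_upto Q 0 t x A = 0"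
| "jump_trans_upto Q (Suc n) t x A =
     ennreal (exp (- total_rate Q x * t)) * indicator A x +
     (\<integral>\<^sup>+ s\<in>{0..t}. ennreal (exp (- total_rate Q x * s)) *
        (\<integral>\<^sup>+ y. jump_trans_upto Q n (t - s) y A \<partial>Q x) \<partial>lborel)"

definition jump_trans :: "('s \<Rightarrow> 's measure) \<Rightarrow> real \<Rightarrow> 's \<Rightarrow> 's set \<Rightarrow> ennreal" where
  "jump_trans Q t x A = (SUP n. jump_trans_upto Q n t x A)"

definition stationary_distribution ::
  "'s measure \<Rightarrow> ('s \<Rightarrow> 's measure) \<Rightarrow> 's measure \<Rightarrow> bool" where
  "stationary_distribution S Q \<pi> \<longleftrightarrow>
     prob_space \<pi> \<and> sets \<pi> = sets S \<and>
     (\<forall>t\<ge>0. \<forall>A\<in>sets S. (\<integral>\<^sup>+ x. jump_trans Q t x A \<partial>\<pi>) = emeasure \<pi> A)"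


section \<open>Finite lists as a measurable space\<close>

text \<open>
  The disjoint union over \<open>n\<close> of the \<open>n\<close>-fold product \<open>\<sigma>\<close>-algebras;
  \<open>listset [A\<^sub>1, \<dots>, A\<^sub>n]\<close> is the box \<open>A\<^sub>1 \<times> \<dots> \<times> A\<^sub>n\<close> of lists of length \<open>n\<close>.
\<close>

definition list_space :: "'a measure \<Rightarrow> 'a list measure" where
  "list_space M = sigma (lists (space M)) {listset As | As. As \<in> lists (sets M)}"


section \<open>The FIFM matching process\<close>

datatype colour = Red | Blue

fun opp :: "colour \<Rightarrow> colour" where
  "opp Red = Blue"
| "opp Blue = Red"

type_synonym 'a particle = "'a \<times> colour"

definition nbhd :: "'a::metric_space particle \<Rightarrow> 'a particle set" where
  "nbhd x = {y. snd y = opp (snd x) \<and> dist (fst x) (fst y) < 1}"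

definition nbhds :: "'a::metric_space particle set \<Rightarrow> 'a particle set" where
  "nbhds A = (\<Union>x\<in>A. nbhd x)"

definition particle_measure :: "'a::metric_space measure \<Rightarrow> 'a particle measure" where
  "particle_measure lam = lam \<Otimes>\<^sub>M count_space UNIV"

definition fifm_space :: "'a::metric_space particle list measure" where
  "fifm_space = list_space (borel \<Otimes>\<^sub>M count_space UNIV)"

text \<open>List positions are counted from 0, so \<open>take i \<eta>\<close> are the particles that precede \<open>\<eta> ! i\<close>.\<close>

definition exclusive_nbhd :: "'a::metric_space particle list \<Rightarrow> nat \<Rightarrow> 'a particle set" where
  "exclusive_nbhd \<eta> i = nbhd (\<eta> ! i) - nbhds (set (take i \<eta>))"

definition remove_nth :: "nat \<Rightarrow> 'b list \<Rightarrow> 'b list" where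
  "remove_nth i xs = take i xs @ drop (Suc i) xs"

definition fifm_rates ::
  "'a::metric_space measure \<Rightarrow> real \<Rightarrow> 'a particle list \<Rightarrow> 'a particle list measure" where
  "fifm_rates lam mu \<eta> =
     measure_of (space fifm_space) (sets fifm_space)
       (\<lambda>A. (\<Sum>i<length \<eta>. (ennreal mu + emeasure (particle_measure lam) (exclusive_nbhd \<eta> i))
                             * indicator A (remove_nth i \<eta>))
          + emeasure (particle_measure lam) {x. x \<notin> nbhds (set \<eta>) \<and> \<eta> @ [x] \<in> A})"

text \<open>The set function in the definition of \<open>fifm_rates\<close> is countably additive, so it really is the rate measure.\<close>

lemma space_list_space: "space (list_space M) = lists (space M)"
  and sets_list_space: "sets (list_space M) = sigma_sets (lists (space M)) {listset As | As. As \<in> lists (sets M)}"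
proof -
  have *: "listset As \<subseteq> lists (space M)" if "As \<in> lists (sets M)" for As
    using that by (induction As) (auto simp: set_Cons_def; (drule sets.sets_into_space)?; blast)+
  have "{listset As | As. As \<in> lists (sets M)} \<subseteq> Pow (lists (space M))"
    using * by auto
  then show "space (list_space M) = lists (space M)"
   "sets (list_space M) = sigma_sets (lists (space M)) {listset As | As. As \<in> lists (sets M)}"
    by (auto simp: list_space_def space_measure_of_conv sets_measure_of)
qed

lemma append1_listset: "length xs = m \<Longrightarrow> {x. xs @ [x] \<in> listset As} = {} \<or> (\<exists>A\<in>set As. {x. xs @ [x] \<in> listset As} = A)"
  apply (induction As arbitrary: xs m)
   apply auto[1]
  subgoal for A As xs m
    apply (cases xs)
     apply (cases As)
      apply (auto simp: set_Cons_def)[1]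
     apply (auto simp: set_Cons_def)[1]
    apply (auto simp: set_Cons_def)
    done
  done

lemma nbhd_sets: "nbhd x \<in> sets (borel \<Otimes>\<^sub>M count_space UNIV)"
proof -
  have "nbhd x = ball (fst x) 1 \<times> {opp (snd x)}" by (auto simp: nbhd_def)
  then show ?thesis by auto
qed

lemma append1_measurable:
  assumes "set xs \<subseteq> space M" shows "(\<lambda>x. xs @ [x]) \<in> measurable M (list_space M)"
  unfolding list_space_def
proof (rule measurable_measure_of)
  show "{listset As | As. As \<in> lists (sets M)} \<subseteq> Pow (lists (space M))"
    using sets.space_closed[of "list_space M"] unfolding space_list_space sets_list_space
    by (meson Sigma_Algebra.sigma_sets.Basic subset_eq)
  show "(\<lambda>x. xs @ [x]) \<in> space M \<rightarrow> lists (space M)" using assms by auto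
  fix Y assume "Y \<in> {listset As | As. As \<in> lists (sets M)}"
  then obtain As where As: "As \<in> lists (sets M)" "Y = listset As" by auto
  have "(\<lambda>x. xs @ [x]) -` Y = {} \<or> (\<lambda>x. xs @ [x]) -` Y \<in> sets M"
    using append1_listset[OF refl, of xs As] As by (auto simp: vimage_def)
  then show "(\<lambda>x. xs @ [x]) -` Y \<inter> space M \<in> sets M" by auto
qed

lemma emeasure_fifm_rates:
  fixes lam :: "'a::metric_space measure"
  assumes l: "sets lam = sets borel" and A: "A \<in> sets fifm_space"
  shows "emeasure (fifm_rates lam mu \<eta>) A =
     (\<Sum>i<length \<eta>. (ennreal mu + emeasure (particle_measure lam) (exclusive_nbhd \<eta> i))
                             * indicator A (remove_nth i \<eta>))
          + emeasure (particle_measure lam) {x. x \<notin> nbhds (set \<eta>) \<and> \<eta> @ [x] \<in> A}" (is "_ = ?f A")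
proof -
  let ?B = "borel \<Otimes>\<^sub>M count_space (UNIV::colour set) :: ('a\<times>colour) measure"
  have sb: "sets (particle_measure lam) = sets ?B"
    unfolding particle_measure_def by (rule sets_pair_measure_cong) (use l in auto)
  have sp: "space ?B = UNIV" by (simp add: space_pair_measure)
  have N: "nbhds (set \<eta>) \<in> sets ?B" unfolding nbhds_def by (intro sets.finite_UN) (auto simp: nbhd_sets)
  have ap: "(\<lambda>x. \<eta> @ [x]) \<in> measurable ?B fifm_space"
    unfolding fifm_space_def by (rule append1_measurable) (auto simp: sp)
  have G: "{x. x \<notin> nbhds (set \<eta>) \<and> \<eta> @ [x] \<in> A} \<in> sets (particle_measure lam)" if "A \<in> sets fifm_space" for A
  proof -
    have "{x. x \<notin> nbhds (set \<eta>) \<and> \<eta> @ [x] \<in> A} = ((\<lambda>x. \<eta> @ [x]) -` A \<inter> space ?B) - nbhds (set \<eta>)"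
      by (auto simp: sp)
    then show ?thesis using measurable_sets[OF ap that] N sb by auto
  qed
  show ?thesis
  proof (rule emeasure_measure_of[OF fifm_rates_def])
    show "sets fifm_space \<subseteq> Pow (space (fifm_space::'a particle list measure))" by (rule sets.space_closed)
    have se: "sets (fifm_rates lam mu \<eta>) = sets fifm_space" 
      by (simp add: fifm_rates_def sets.sigma_sets_eq sets.space_closed)
    show "A \<in> sets (fifm_rates lam mu \<eta>)" using A se by simp
    show "positive (sets (fifm_rates lam mu \<eta>)) ?f" by (simp add: positive_def)
    show "countably_additive (sets (fifm_rates lam mu \<eta>)) ?f"
      unfolding se countably_additive_def
    proof (intro allI impI)
      fix F :: "nat \<Rightarrow> 'a particle list set"
      assume F: "range F \<subseteq> sets fifm_space" "disjoint_family F" "\<Union>(range F) \<in> sets fifm_space"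
      let ?G = "\<lambda>A. {x. x \<notin> nbhds (set \<eta>) \<and> \<eta> @ [x] \<in> A}"
      have U: "?G (\<Union>(range F)) = (\<Union>n. ?G (F n))" by auto
      have 1: "(\<Sum>n. emeasure (particle_measure lam) (?G (F n))) = emeasure (particle_measure lam) (?G (\<Union>(range F)))"
        unfolding U using F G by (intro suminf_emeasure) (auto simp: disjoint_family_on_def)
      have 2: "(\<Sum>n. indicator (F n) z) = (indicator (\<Union>(range F)) z :: ennreal)" for z
        using suminf_indicator[OF F(2)] by auto
      show "(\<Sum>n. ?f (F n)) = ?f (\<Union>(range F))"
        apply (subst suminf_add[symmetric])
        apply (rule summableI)+
        apply (subst suminf_sum)
        apply (rule summableI)
        apply (subst ennreal_suminf_cmult)
        apply (simp only: 1 2)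
        done
    qed
  qed
qed

end

(* The total jump rate out of a list of length n is n * mu + 2 * lam(D), removals have rate at least n * mu
   and arrivals rate at most 2 * lam(D), so the length is controlled by an M/M/infinity queue.

   Existence: a Lyapunov function of the length bounds the expected number of jumps in an excursion from
   the empty list; the expected occupation time of such an excursion is a finite measure pi that gives the
   jump rate a finite integral and satisfies the balance equation pi Q f = pi (q f). The integrated
   backward equation P_t f + int_0^t q P_s f ds = f + int_0^t Q P_s f ds then yields pi P_t = pi.

   Uniqueness: from every list the process is empty at time 1 with positive probability. On the part of a
   Hahn decomposition of the difference of two invariant distributions that does not contain the empty
   list, the difference would therefore lose mass, so it vanishes there. *)
theory Submission
  imports Defs
begin

section \<open>The integrated backward equation\<close>

text \<open>The jump rate grows with the length of the list and is unbounded, so the transition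
  function cannot be treated as the exponential of a bounded operator. \<open>jump_trans\<close> is
  a supremum of truncated recursions with values in \<open>ennreal\<close>. Identities are therefore
  kept as equalities between sums of nonnegative integrals, and a term is cancelled only once it is
  known to be finite; this is the purpose of the finite integral of the jump rate under pi. The
  length alone need not be a Markov chain: whether an arrival is matched or joins depends on
  positions and colours. The two rates always add up to the same total, however, so a Lyapunov
  inequality that holds for every such split is enough. It counts jumps and not time because q dpi
  is, up to normalisation, the expected number of visits of the embedded chain. If lam vanishes, the
  empty list is absorbing and has no excursions; this case is separate. The lower bound found for
  the chance of being empty at time 1 depends on the length of the starting list. A Hahn
  decomposition works with such a pointwise bound, where a uniform contraction would not.\<close>

lemma nn_integral_exp_Icc:
  fixes q t s :: real
  assumes "0 \<le> q" "s \<le> t"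
  shows "(\<integral>\<^sup>+ r\<in>{s..t}. ennreal (q * exp (- q * (r - s))) \<partial>lborel) = ennreal (1 - exp (- q * (t - s)))"
proof -
  have "(\<integral>\<^sup>+ r. ennreal (q * exp (- q * (r - s))) * indicator {s..t} r \<partial>lborel)
      = ennreal (- exp (- q * (t - s)) - - exp (- q * (s - s)))"
    using assms
    by (intro nn_integral_FTC_Icc) (auto intro!: derivative_eq_intros simp: has_real_derivative_iff_has_vector_derivative[symmetric])
  then show ?thesis by simp
qed

lemma nn_integral_Icc_reflect:
  fixes h :: "real \<Rightarrow> real \<Rightarrow> ennreal"
  assumes "(\<lambda>(s, r). h s r) \<in> borel_measurable (borel \<Otimes>\<^sub>M borel)"
  shows "(\<integral>\<^sup>+ s\<in>{0..t}. h s (t - s) \<partial>lborel) = (\<integral>\<^sup>+ s\<in>{0..t}. h (t - s) s \<partial>lborel)"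
proof -
  have [measurable]: "(\<lambda>s. h (f s) (g s)) \<in> borel_measurable borel"
    if "f \<in> borel_measurable borel" "g \<in> borel_measurable borel" for f g :: "real \<Rightarrow> real"
    using measurable_compose[OF measurable_Pair[OF that] assms] by simp
  have "(\<integral>\<^sup>+ s. h s (t - s) * indicator {0..t} s \<partial>lborel)
      = \<bar>-1::real\<bar> * (\<integral>\<^sup>+ s. h (t + -1 * s) (t - (t + -1 * s)) * indicator {0..t} (t + -1 * s) \<partial>lborel)"
    by (rule nn_integral_real_affine) auto
  also have "\<dots> = (\<integral>\<^sup>+ s. h (t - s) s * indicator {0..t} s \<partial>lborel)"
    by (auto intro!: nn_integral_cong simp: indicator_def)
  finally show ?thesis .
qed

text \<open>The variation-of-constants formula turned back into the integrated equation \<open>u' = - q u + h\<close>;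
  both sides are arranged so that no subtraction in \<open>ennreal\<close> occurs.\<close>
lemma duhamel_integrated:
  fixes u h :: "real \<Rightarrow> ennreal"
  assumes q: "0 \<le> q" and t: "0 \<le> t"
    and h [measurable]: "h \<in> borel_measurable borel"
    and u: "\<And>r. 0 \<le> r \<Longrightarrow> u r = ennreal (exp (- q * r)) * a
              + (\<integral>\<^sup>+ s\<in>{0..r}. ennreal (exp (- q * s)) * h (r - s) \<partial>lborel)"
  shows "u t + (\<integral>\<^sup>+ r\<in>{0..t}. ennreal q * u r \<partial>lborel) = a + (\<integral>\<^sup>+ s\<in>{0..t}. h s \<partial>lborel)"
proof -
  \<comment> \<open>Reflection moves the time shift from \<open>h\<close> to the exponential, so
    that Fubini over the triangle 0 <= s <= r <= t leaves an exponential integral in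
    \<open>r\<close> alone.\<close>
  have u': "u r = ennreal (exp (- q * r)) * a
      + (\<integral>\<^sup>+ s\<in>{0..r}. ennreal (exp (- q * (r - s))) * h s \<partial>lborel)" if "0 \<le> r" for r
    unfolding u[OF that] by (subst nn_integral_Icc_reflect[where h="\<lambda>s r. ennreal (exp (- q * s)) * h r"]) auto
  have A: "(\<integral>\<^sup>+ r\<in>{0..t}. ennreal (q * exp (- q * r)) * a \<partial>lborel) = ennreal (1 - exp (- q * t)) * a"
  proof -
    have "(\<integral>\<^sup>+ r\<in>{0..t}. ennreal (q * exp (- q * r)) * a \<partial>lborel)
       = (\<integral>\<^sup>+ r. (ennreal (q * exp (- q * (r - 0))) * indicator {0..t} r) * a \<partial>lborel)"
      by (intro nn_integral_cong) (simp add: ac_simps)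
    also have "\<dots> = (\<integral>\<^sup>+ r\<in>{0..t}. ennreal (q * exp (- q * (r - 0))) \<partial>lborel) * a"
      by (rule nn_integral_multc) auto
    also have "\<dots> = ennreal (1 - exp (- q * t)) * a"
      by (subst nn_integral_exp_Icc[OF q t]) simp
    finally show ?thesis .
  qed
  have B: "(\<integral>\<^sup>+ r\<in>{0..t}. (\<integral>\<^sup>+ s\<in>{0..r}. ennreal (q * exp (- q * (r - s))) * h s \<partial>lborel) \<partial>lborel)
      = (\<integral>\<^sup>+ s\<in>{0..t}. ennreal (1 - exp (- q * (t - s))) * h s \<partial>lborel)" (is "?L = ?R")
  proof -
    have "?L = (\<integral>\<^sup>+ r. (\<integral>\<^sup>+ s. ennreal (q * exp (- q * (r - s))) * h s * indicator {0..r} s * indicator {0..t} r \<partial>lborel) \<partial>lborel)"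
      by (intro nn_integral_cong) (simp add: nn_integral_multc)
    also have "\<dots> = (\<integral>\<^sup>+ s. (\<integral>\<^sup>+ r. ennreal (q * exp (- q * (r - s))) * h s * indicator {0..r} s * indicator {0..t} r \<partial>lborel) \<partial>lborel)"
      by (rule lborel_pair.Fubini') (auto simp: indicator_def)
    also have "\<dots> = (\<integral>\<^sup>+ s. (\<integral>\<^sup>+ r. (ennreal (q * exp (- q * (r - s))) * indicator {s..t} r) * (h s * indicator {0..t} s) \<partial>lborel) \<partial>lborel)"
      by (intro nn_integral_cong) (auto simp: indicator_def)
    also have "\<dots> = (\<integral>\<^sup>+ s. (\<integral>\<^sup>+ r\<in>{s..t}. ennreal (q * exp (- q * (r - s))) \<partial>lborel) * (h s * indicator {0..t} s) \<partial>lborel)"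
      by (intro nn_integral_cong nn_integral_multc) auto
    also have "\<dots> = ?R"
    proof (intro nn_integral_cong)
      fix s
      show "(\<integral>\<^sup>+ r\<in>{s..t}. ennreal (q * exp (- q * (r - s))) \<partial>lborel) * (h s * indicator {0..t} s)
          = ennreal (1 - exp (- q * (t - s))) * h s * indicator {0..t} s"
      proof (cases "s \<le> t")
        case True
        then show ?thesis by (subst nn_integral_exp_Icc[OF q True]) (simp add: mult.assoc)
      qed simp
    qed
    finally show ?thesis .
  qed
  have "(\<integral>\<^sup>+ r\<in>{0..t}. ennreal q * u r \<partial>lborel)
      = (\<integral>\<^sup>+ r. ennreal (q * exp (- q * r)) * a * indicator {0..t} r
           + (\<integral>\<^sup>+ s\<in>{0..r}. ennreal (q * exp (- q * (r - s))) * h s \<partial>lborel) * indicator {0..t} r \<partial>lborel)"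
  proof (intro nn_integral_cong)
    fix r
    have "ennreal q * (\<integral>\<^sup>+ s\<in>{0..r}. ennreal (exp (- q * (r - s))) * h s \<partial>lborel)
      = (\<integral>\<^sup>+ s\<in>{0..r}. ennreal (q * exp (- q * (r - s))) * h s \<partial>lborel)"
      by (subst nn_integral_cmult[symmetric]) (auto intro!: nn_integral_cong simp: ennreal_mult' q ac_simps)
    then show "ennreal q * u r * indicator {0..t} r =
        ennreal (q * exp (- q * r)) * a * indicator {0..t} r
        + (\<integral>\<^sup>+ s\<in>{0..r}. ennreal (q * exp (- q * (r - s))) * h s \<partial>lborel) * indicator {0..t} r"
      by (auto simp: indicator_def u' distrib_left ennreal_mult' q ac_simps)
  qed
  also have "\<dots> = ennreal (1 - exp (- q * t)) * a + (\<integral>\<^sup>+ s\<in>{0..t}. ennreal (1 - exp (- q * (t - s))) * h s \<partial>lborel)"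
    unfolding A[symmetric] B[symmetric]
    by (rule nn_integral_add) (auto simp: indicator_def)
  \<comment> \<open>The weight \<open>exp (- q * (t - s))\<close> from \<open>u t\<close> and the
    weight \<open>1 - exp (- q * (t - s))\<close> from the integrated loss term add up to 1; the two
    coefficients of \<open>a\<close> do the same.\<close>
  finally have "u t + (\<integral>\<^sup>+ r\<in>{0..t}. ennreal q * u r \<partial>lborel)
     = (ennreal (exp (- q * t)) + ennreal (1 - exp (- q * t))) * a
     + ((\<integral>\<^sup>+ s\<in>{0..t}. ennreal (exp (- q * (t - s))) * h s \<partial>lborel)
        + (\<integral>\<^sup>+ s\<in>{0..t}. ennreal (1 - exp (- q * (t - s))) * h s \<partial>lborel))"
    by (simp only: u'[OF t] distrib_right add.assoc add.left_commute)
  also have "(ennreal (exp (- q * t)) + ennreal (1 - exp (- q * t))) = 1"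
    using q t by (subst ennreal_plus[symmetric]) auto
  also have "((\<integral>\<^sup>+ s\<in>{0..t}. ennreal (exp (- q * (t - s))) * h s \<partial>lborel)
        + (\<integral>\<^sup>+ s\<in>{0..t}. ennreal (1 - exp (- q * (t - s))) * h s \<partial>lborel))
      = (\<integral>\<^sup>+ s\<in>{0..t}. (ennreal (exp (- q * (t - s))) + ennreal (1 - exp (- q * (t - s)))) * h s \<partial>lborel)"
    by (subst nn_integral_add[symmetric]) (auto simp: distrib_right intro!: nn_integral_cong)
  also have "\<dots> = (\<integral>\<^sup>+ s\<in>{0..t}. h s \<partial>lborel)"
  proof (intro nn_integral_cong)
    fix s
    have "ennreal (exp (- q * (t - s))) + ennreal (1 - exp (- q * (t - s))) = 1" if "s \<le> t"
      using q that by (subst ennreal_plus[symmetric]) auto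
    then show "(ennreal (exp (- q * (t - s))) + ennreal (1 - exp (- q * (t - s)))) * h s * indicator {0..t} s
        = h s * indicator {0..t} s"
      by (auto simp: indicator_def)
  qed
  finally show ?thesis by simp
qed

section \<open>Jump processes with a measurable rate kernel\<close>

locale rate_kernel =
  fixes S :: "'s measure" and Q :: "'s \<Rightarrow> 's measure"
  assumes sets_Q: "x \<in> space S \<Longrightarrow> sets (Q x) = sets S"
    and measurable_emeasure_Q: "A \<in> sets S \<Longrightarrow> (\<lambda>x. emeasure (Q x) A) \<in> borel_measurable S"
    and finite_Q: "x \<in> space S \<Longrightarrow> emeasure (Q x) (space S) \<noteq> \<infinity>"
begin

lemma space_Q: "x \<in> space S \<Longrightarrow> space (Q x) = space S"
  using sets_Q sets_eq_imp_space_eq by blast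

lemma borel_measurable_Q: "x \<in> space S \<Longrightarrow> borel_measurable (Q x) = borel_measurable S"
  using sets_Q measurable_cong_sets by blast

lemma emeasure_space_Q: "x \<in> space S \<Longrightarrow> emeasure (Q x) (space S) = ennreal (total_rate Q x)"
  unfolding total_rate_def using finite_Q[of x] by (simp add: space_Q emeasure_eq_ennreal_measure)

lemma total_rate_nonneg: "0 \<le> total_rate Q x"
  by (simp add: total_rate_def)

lemma measurable_total_rate [measurable]: "total_rate Q \<in> borel_measurable S"
proof -
  have "(\<lambda>x. enn2real (emeasure (Q x) (space S))) \<in> borel_measurable S"
    using measurable_emeasure_Q[OF sets.top] by measurable
  then show ?thesis
    by (rule measurable_cong[THEN iffD1, rotated])
      (simp add: emeasure_space_Q total_rate_nonneg)
qed

text \<open>The calculus of measurable kernels lives on \<open>subprob_algebra\<close>; a kernel of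
  arbitrary finite mass is brought there by a state-dependent scaling.\<close>

lemma measurable_scaled_kernel:
  assumes c: "c \<in> borel_measurable S" and le: "\<And>x. x \<in> space S \<Longrightarrow> c x * ennreal (total_rate Q x) \<le> 1"
    and ne: "space S \<noteq> {}"
  shows "(\<lambda>x. scale_measure (c x) (Q x)) \<in> measurable S (subprob_algebra S)"
proof (rule measurable_subprob_algebra)
  show "subprob_space (scale_measure (c x) (Q x))" if "x \<in> space S" for x
    using that ne le[OF that]
    by (intro subprob_spaceI) (auto simp: space_scale_measure space_Q emeasure_space_Q)
  show "(\<lambda>x. emeasure (scale_measure (c x) (Q x)) A) \<in> borel_measurable S" if "A \<in> sets S" for A
    using measurable_emeasure_Q[OF that] c by simp
qed (simp add: sets_Q)

text \<open>Scale the kernel to mass at most 1, integrate, and undo the scaling. The parameter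
  \<open>v\<close> lets the integrand depend on times as well as on the state.\<close>

lemma measurable_nn_integral_kernel:
  assumes f: "(\<lambda>(v, y). f v y) \<in> borel_measurable (M \<Otimes>\<^sub>M S)" and g [measurable]: "g \<in> measurable M S"
  shows "(\<lambda>v. \<integral>\<^sup>+ y. f v y \<partial>Q (g v)) \<in> borel_measurable M"
proof (cases "space M = {}")
  case False
  then have ne: "space S \<noteq> {}" using g by (auto simp: measurable_def)
  \<comment> \<open>The summand 1 keeps the factor invertible at absorbing states, where the total
    rate is 0.\<close>
  define c where "c x = ennreal (1 / (1 + total_rate Q x))" for x
  have c: "c \<in> borel_measurable S" unfolding c_def by measurable
  have "c x * ennreal (total_rate Q x) \<le> 1" for x
    using total_rate_nonneg[of x] by (simp add: c_def ennreal_mult''[symmetric])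
  note L = measurable_compose[OF g measurable_scaled_kernel[OF c this ne]]
  have "(\<lambda>v. \<integral>\<^sup>+ y. f v y \<partial>scale_measure (c (g v)) (Q (g v))) \<in> borel_measurable M"
    by (rule nn_integral_measurable_subprob_algebra2[OF f L])
  then have "(\<lambda>v. ennreal (1 + total_rate Q (g v)) * (\<integral>\<^sup>+ y. f v y \<partial>scale_measure (c (g v)) (Q (g v)))) \<in> borel_measurable M"
    by measurable
  then show ?thesis
  proof (rule measurable_cong[THEN iffD1, rotated])
    fix v assume v: "v \<in> space M"
    then have gv: "g v \<in> space S" using g by (auto simp: measurable_def)
    have [measurable]: "f v \<in> borel_measurable S"
      using measurable_compose[OF measurable_Pair1'[OF v] f] by simp
    have "ennreal (1 + total_rate Q (g v)) * c (g v) = 1"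
      unfolding c_def using total_rate_nonneg[of "g v"]
      by (subst ennreal_mult[symmetric]) (auto simp: add_nonneg_eq_0_iff)
    then show "ennreal (1 + total_rate Q (g v)) * (\<integral>\<^sup>+ y. f v y \<partial>scale_measure (c (g v)) (Q (g v)))
        = (\<integral>\<^sup>+ y. f v y \<partial>Q (g v))"
      by (simp add: nn_integral_scale_measure borel_measurable_Q[OF gv] mult.assoc[symmetric])
  qed
qed (simp add: measurable_def)

lemma measurable_nn_integral_Q:
  assumes "f \<in> borel_measurable S"
  shows "(\<lambda>x. \<integral>\<^sup>+ y. f y \<partial>Q x) \<in> borel_measurable S"
  by (rule measurable_nn_integral_kernel[where f="\<lambda>_. f" and g="\<lambda>x. x"])
    (use measurable_compose[OF measurable_snd assms] in \<open>simp_all add: case_prod_beta'\<close>)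

text \<open>Time and state have to be treated jointly, because the recursion integrates the previous
  function over the next state at the shifted time \<open>t - s\<close>.\<close>

lemma measurable_jump_trans_upto:
  assumes A [measurable]: "A \<in> sets S"
  shows "(\<lambda>(t, x). jump_trans_upto Q n t x A) \<in> borel_measurable (borel \<Otimes>\<^sub>M S)"
proof (induction n)
  case (Suc n)
  let ?M = "(borel \<Otimes>\<^sub>M S) \<Otimes>\<^sub>M (lborel :: real measure)"
  have "(\<lambda>v. \<integral>\<^sup>+ y. jump_trans_upto Q n (fst (fst v) - snd v) y A \<partial>Q (snd (fst v))) \<in> borel_measurable ?M"
  proof (rule measurable_nn_integral_kernel)
    have "(\<lambda>z. (fst (fst (fst z)) - snd (fst z), snd z)) \<in> measurable (?M \<Otimes>\<^sub>M S) (borel \<Otimes>\<^sub>M S)"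
      by measurable
    from measurable_compose[OF this Suc.IH]
    show "(\<lambda>(v, y). jump_trans_upto Q n (fst (fst v) - snd v) y A) \<in> borel_measurable (?M \<Otimes>\<^sub>M S)"
      by (simp add: case_prod_beta')
  qed measurable
  then have "(\<lambda>v. ennreal (exp (- total_rate Q (snd (fst v)) * snd v)) *
      (\<integral>\<^sup>+ y. jump_trans_upto Q n (fst (fst v) - snd v) y A \<partial>Q (snd (fst v))) *
      (if 0 \<le> snd v \<and> snd v \<le> fst (fst v) then 1 else 0)) \<in> borel_measurable ?M"
    by measurable
  then have "(\<lambda>(p, s). ennreal (exp (- total_rate Q (snd p) * s)) *
      (\<integral>\<^sup>+ y. jump_trans_upto Q n (fst p - s) y A \<partial>Q (snd p)) * indicator {0..fst p} s) \<in> borel_measurable ?M"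
    by (simp add: case_prod_beta' indicator_def of_bool_def)
  then have "(\<lambda>p. \<integral>\<^sup>+ s. ennreal (exp (- total_rate Q (snd p) * s)) *
      (\<integral>\<^sup>+ y. jump_trans_upto Q n (fst p - s) y A \<partial>Q (snd p)) * indicator {0..fst p} s \<partial>lborel)
       \<in> borel_measurable (borel \<Otimes>\<^sub>M S)"
    by (rule lborel.borel_measurable_nn_integral)
  then have "(\<lambda>p. ennreal (exp (- total_rate Q (snd p) * fst p)) * indicator A (snd p) +
      (\<integral>\<^sup>+ s. ennreal (exp (- total_rate Q (snd p) * s)) *
      (\<integral>\<^sup>+ y. jump_trans_upto Q n (fst p - s) y A \<partial>Q (snd p)) * indicator {0..fst p} s \<partial>lborel))
       \<in> borel_measurable (borel \<Otimes>\<^sub>M S)"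
    by measurable
  then show ?case by (simp add: case_prod_beta')
qed simp

lemma measurable_jump_trans:
  assumes A: "A \<in> sets S"
  shows "(\<lambda>(t, x). jump_trans Q t x A) \<in> borel_measurable (borel \<Otimes>\<^sub>M S)"
proof -
  have "(\<lambda>p. SUP n. (\<lambda>(t, x). jump_trans_upto Q n t x A) p) \<in> borel_measurable (borel \<Otimes>\<^sub>M S)"
    using measurable_jump_trans_upto[OF A] by measurable
  then show ?thesis by (simp add: jump_trans_def case_prod_beta')
qed

end

section \<open>Uniqueness of invariant distributions\<close>

text \<open>Restricting both measures to \<open>Y\<close> turns the inequality on subsets of
  \<open>Y\<close> into the order of measures, for which the integral is monotone.\<close>

lemma nn_integral_mono_on_dominated_set:
  assumes sets: "sets M = sets S" "sets N = sets S" and Y: "Y \<in> sets S"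
    and le: "\<And>X. X \<in> sets S \<Longrightarrow> X \<subseteq> Y \<Longrightarrow> emeasure N X \<le> emeasure M X"
    and f: "f \<in> borel_measurable S"
  shows "(\<integral>\<^sup>+ x\<in>Y. f x \<partial>N) \<le> (\<integral>\<^sup>+ x\<in>Y. f x \<partial>M)"
proof -
  have [simp]: "f \<in> borel_measurable M" "f \<in> borel_measurable N" "Y \<in> sets M" "Y \<in> sets N"
    using f Y sets by (auto cong: measurable_cong_sets)
  have "density N (indicator Y) \<le> density M (indicator Y)"
    unfolding le_measure_iff
  proof (simp add: sets sets_eq_imp_space_eq[OF sets(1)] sets_eq_imp_space_eq[OF sets(2)], rule le_funI)
    fix X
    show "emeasure (density N (indicator Y)) X \<le> emeasure (density M (indicator Y)) X"
    proof (cases "X \<in> sets S")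
      case True
      have "emeasure N (Y \<inter> X) \<le> emeasure M (Y \<inter> X)"
        using le[of "Y \<inter> X"] True Y by auto
      then show ?thesis using True Y sets by (simp add: emeasure_restricted)
    qed (simp add: sets emeasure_notin_sets)
  qed
  then have "(\<integral>\<^sup>+ x. f x \<partial>density N (indicator Y)) \<le> (\<integral>\<^sup>+ x. f x \<partial>density M (indicator Y))"
    by (intro nn_integral_mono_measure) (simp_all add: sets)
  then show ?thesis
    by (simp add: nn_integral_density borel_measurable_indicator mult.commute)
qed

text \<open>Take a Hahn decomposition of \<open>N - M\<close>, with \<open>x\<^sub>0\<close> on the side where \<open>M\<close> dominates. Invariance shows
  that no mass of \<open>N - M\<close> leaves the other side \<open>C\<close> in one step, but from every point of \<open>C\<close> there is a
  positive chance to leave it, namely to \<open>x\<^sub>0\<close>; so \<open>C\<close> carries no mass of \<open>N - M\<close>.\<close>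
lemma invariant_prob_le:
  fixes K :: "'s \<Rightarrow> 's set \<Rightarrow> ennreal"
  assumes M: "prob_space M" "sets M = sets S" and N: "prob_space N" "sets N = sets S"
    and K: "\<And>A. A \<in> sets S \<Longrightarrow> (\<lambda>x. K x A) \<in> borel_measurable S"
    and sub: "\<And>x A B. x \<in> space S \<Longrightarrow> A \<in> sets S \<Longrightarrow> B \<in> sets S \<Longrightarrow> A \<inter> B = {} \<Longrightarrow> K x A + K x B \<le> 1"
    and x0: "{x0} \<in> sets S" and pos: "\<And>x. x \<in> space S \<Longrightarrow> 0 < K x {x0}"
    and invM: "\<And>A. A \<in> sets S \<Longrightarrow> (\<integral>\<^sup>+ x. K x A \<partial>M) = emeasure M A"
    and invN: "\<And>A. A \<in> sets S \<Longrightarrow> (\<integral>\<^sup>+ x. K x A \<partial>N) = emeasure N A"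
    and C: "C \<in> sets S" "x0 \<notin> C"
    and leC: "\<And>X. X \<in> sets S \<Longrightarrow> X \<subseteq> C \<Longrightarrow> emeasure M X \<le> emeasure N X"
    and leH: "\<And>X. X \<in> sets S \<Longrightarrow> X \<subseteq> space S - C \<Longrightarrow> emeasure N X \<le> emeasure M X"
    and A: "A \<in> sets S"
  shows "emeasure N A \<le> emeasure M A"
proof -
  interpret M: prob_space M by fact
  interpret N: prob_space N by fact
  let ?H = "space S - C"
  \<comment> \<open>\<open>k\<close> is the chance to be in \<open>C\<close> after one step. Its
    complement \<open>m\<close> also collects the mass that \<open>K\<close> may lose, so
    \<open>k + m = 1\<close> although \<open>K\<close> is only sub-Markov.\<close>
  define k m where "k x = K x C" and "m x = 1 - K x C" for x
  have k [measurable]: "k \<in> borel_measurable S" unfolding k_def using K[OF C(1)] .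
  have m [measurable]: "m \<in> borel_measurable S" unfolding m_def using K[OF C(1)] by measurable
  have le1: "K x C + K x {x0} \<le> 1" if "x \<in> space S" for x
    using sub[OF that C(1) x0] C(2) by auto
  have km: "k x + m x = 1" if "x \<in> space S" for x
  proof -
    have "K x C \<le> 1" using le1[OF that] by (meson add_increasing2 order_trans zero_le le_iff_add)
    then show ?thesis unfolding k_def m_def by (metis add_diff_inverse_ennreal)
  qed
  have mpos: "0 < m x" if "x \<in> space S" for x
  proof (rule ccontr)
    assume "\<not> 0 < m x"
    then have k1: "k x = 1" using km[OF that] by simp
    with le1[OF that] have "1 + K x {x0} \<le> 1 + 0" by (simp add: k_def)
    with pos[OF that] show False by (simp add: ennreal_add_left_cancel_le del: add_0_right)
  qed
  have meas_C: "(\<integral>\<^sup>+ x\<in>C. k x \<partial>P) + (\<integral>\<^sup>+ x\<in>C. m x \<partial>P) = emeasure P C"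
    if "sets P = sets S" for P
  proof -
    have [measurable]: "k \<in> borel_measurable P" "m \<in> borel_measurable P" "C \<in> sets P"
      using that k m C by (auto cong: measurable_cong_sets)
    have "(\<integral>\<^sup>+ x\<in>C. k x \<partial>P) + (\<integral>\<^sup>+ x\<in>C. m x \<partial>P) = (\<integral>\<^sup>+ x\<in>C. k x + m x \<partial>P)"
      by (subst nn_integral_add[symmetric]) (auto simp: distrib_right)
    also have "\<dots> = (\<integral>\<^sup>+ x. indicator C x \<partial>P)"
      using sets_eq_imp_space_eq[OF that] km by (intro nn_integral_cong) auto
    finally show ?thesis by simp
  qed
  have inv_C: "(\<integral>\<^sup>+ x\<in>C. k x \<partial>P) + (\<integral>\<^sup>+ x\<in>?H. k x \<partial>P) = emeasure P C"
    if "sets P = sets S" "(\<integral>\<^sup>+ x. K x C \<partial>P) = emeasure P C" for P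
  proof -
    have [measurable]: "k \<in> borel_measurable P" "C \<in> sets P" "?H \<in> sets P"
      using that k C by (auto cong: measurable_cong_sets)
    have "(\<integral>\<^sup>+ x\<in>C. k x \<partial>P) + (\<integral>\<^sup>+ x\<in>?H. k x \<partial>P) = (\<integral>\<^sup>+ x. k x * indicator C x + k x * indicator ?H x \<partial>P)"
      by (subst nn_integral_add[symmetric]) auto
    also have "\<dots> = (\<integral>\<^sup>+ x. K x C \<partial>P)"
      using sets_eq_imp_space_eq[OF that(1)] by (intro nn_integral_cong) (auto simp: k_def indicator_def)
    finally show ?thesis using that(2) by simp
  qed
  \<comment> \<open>What leaves \<open>C\<close> equals what enters it from \<open>?H\<close>: the
    two decompositions of the mass of \<open>C\<close> share the part that stays in
    \<open>C\<close>, which is finite and cancels.\<close>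
  have flow: "(\<integral>\<^sup>+ x\<in>C. m x \<partial>P) = (\<integral>\<^sup>+ x\<in>?H. k x \<partial>P)"
    if P: "prob_space P" "sets P = sets S" "(\<integral>\<^sup>+ x. K x C \<partial>P) = emeasure P C" for P
  proof -
    have "(\<integral>\<^sup>+ x\<in>C. k x \<partial>P) \<le> emeasure P C"
      using meas_C[OF P(2)] by (metis le_iff_add)
    also have "\<dots> < \<top>" using prob_space.emeasure_le_1[OF P(1), of C] by (simp add: le_less_trans)
    finally show ?thesis
      using meas_C[OF P(2)] inv_C[OF P(2,3)] by (metis ennreal_add_left_cancel infinity_ennreal_def less_irrefl)
  qed
  have "(\<integral>\<^sup>+ x\<in>C. m x \<partial>N) = (\<integral>\<^sup>+ x\<in>?H. k x \<partial>N)" by (rule flow[OF N invN[OF C(1)]])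
  also have "\<dots> \<le> (\<integral>\<^sup>+ x\<in>?H. k x \<partial>M)"
    by (rule nn_integral_mono_on_dominated_set[OF M(2) N(2)]) (use C leH in auto)
  also have "\<dots> = (\<integral>\<^sup>+ x\<in>C. m x \<partial>M)" by (rule flow[OF M invM[OF C(1)], symmetric])
  finally have NM: "(\<integral>\<^sup>+ x\<in>C. m x \<partial>N) \<le> (\<integral>\<^sup>+ x\<in>C. m x \<partial>M)" .
  \<comment> \<open>On \<open>C\<close> the measure \<open>N\<close> dominates \<open>M\<close>, yet
    its integral of \<open>m\<close> is not larger. Level sets on which \<open>m\<close> is bounded
    below turn this into a comparison of masses.\<close>
  define Cn where "Cn n = {x \<in> C. 1 / of_nat (Suc n) \<le> m x}" for n :: nat
  have Cn: "Cn n \<in> sets S" for n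
  proof -
    have "Cn n = C \<inter> {x \<in> space S. 1 / of_nat (Suc n) \<le> m x}"
      using sets.sets_into_space[OF C(1)] by (auto simp: Cn_def)
    then show ?thesis using C(1) by auto
  qed
  have NM_Cn: "emeasure N (Cn n) \<le> emeasure M (Cn n)" for n
  proof -
    define c :: ennreal where "c = 1 / of_nat (Suc n)"
    have c: "0 < c" "c < \<top>"
      by (auto simp: c_def ennreal_zero_less_divide ennreal_divide_eq_top_iff less_top[symmetric])
    \<comment> \<open>\<open>r\<close> is what remains of \<open>m\<close> once \<open>c\<close> is
      removed on \<open>Cn n\<close>. Its integral over \<open>C\<close> is at least as large under
      \<open>N\<close> as under \<open>M\<close>, so the reverse inequality for \<open>m\<close>
      must come from \<open>Cn n\<close>.\<close>
    define r where "r x = m x - c * indicator (Cn n) x" for x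
    have r [measurable]: "r \<in> borel_measurable S" unfolding r_def using Cn by measurable
    have split: "c * emeasure P (Cn n) + (\<integral>\<^sup>+ x\<in>C. r x \<partial>P) = (\<integral>\<^sup>+ x\<in>C. m x \<partial>P)"
      if "sets P = sets S" for P
    proof -
      have [measurable]: "r \<in> borel_measurable P" "m \<in> borel_measurable P" "C \<in> sets P" "Cn n \<in> sets P"
        using that m r C Cn by (auto cong: measurable_cong_sets)
      have "c * emeasure P (Cn n) = (\<integral>\<^sup>+ x. c * indicator (Cn n) x \<partial>P)"
        using that Cn by (simp add: nn_integral_cmult_indicator)
      then have "c * emeasure P (Cn n) + (\<integral>\<^sup>+ x\<in>C. r x \<partial>P) = (\<integral>\<^sup>+ x. c * indicator (Cn n) x + r x * indicator C x \<partial>P)"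
        by (subst nn_integral_add) auto
      also have "\<dots> = (\<integral>\<^sup>+ x\<in>C. m x \<partial>P)"
      proof (intro nn_integral_cong)
        fix x
        have "c * indicator (Cn n) x \<le> m x" by (auto simp: Cn_def c_def indicator_def)
        then have "c * indicator (Cn n) x + r x = m x" unfolding r_def by (metis add_diff_inverse_ennreal)
        moreover have "Cn n \<subseteq> C" by (auto simp: Cn_def)
        ultimately show "c * indicator (Cn n) x + r x * indicator C x = m x * indicator C x"
          by (auto simp: indicator_def)
      qed
      finally show ?thesis .
    qed
    let ?rM = "\<integral>\<^sup>+ x\<in>C. r x \<partial>M"
    have "c * emeasure N (Cn n) + ?rM \<le> c * emeasure N (Cn n) + (\<integral>\<^sup>+ x\<in>C. r x \<partial>N)"
      by (intro add_left_mono nn_integral_mono_on_dominated_set[OF N(2) M(2)]) (use C leC in auto)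
    also have "\<dots> \<le> c * emeasure M (Cn n) + ?rM"
      using NM by (simp add: split[OF M(2)] split[OF N(2)])
    finally have "?rM + c * emeasure N (Cn n) \<le> ?rM + c * emeasure M (Cn n)" by (simp add: add.commute)
    moreover have "?rM \<le> (\<integral>\<^sup>+ x\<in>C. m x \<partial>M)" using split[OF M(2)] by (metis le_iff_add add.commute)
    moreover have "(\<integral>\<^sup>+ x\<in>C. m x \<partial>M) \<le> emeasure M C" using meas_C[OF M(2)] by (metis le_iff_add add.commute)
    ultimately have "c * emeasure N (Cn n) \<le> c * emeasure M (Cn n)"
      using M.emeasure_finite[of C] by (auto simp: ennreal_add_left_cancel_le top_unique)
    then show ?thesis using c by (simp add: ennreal_mult_le_mult_iff)
  qed
  have UCn: "(\<Union>n. Cn n) = C"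
  proof
    show "C \<subseteq> (\<Union>n. Cn n)"
    proof
      fix x assume x: "x \<in> C"
      then have "0 < m x" using mpos sets.sets_into_space[OF C(1)] by auto
      then obtain n where "1 / of_nat (Suc n) < m x"
      proof (cases "m x")
        case (real a)
        with \<open>0 < m x\<close> have "0 < a" by simp
        then obtain n where "1 / real (Suc n) < a" using reals_Archimedean by (auto simp: inverse_eq_divide)
        then have "ennreal (1 / real (Suc n)) < m x" using real \<open>0 < a\<close> by (simp add: ennreal_lessI)
        then show ?thesis using that[of n]
          by (metis divide_ennreal ennreal_1 ennreal_of_nat_eq_real_of_nat of_nat_0_less_iff zero_less_Suc zero_le_one)
      next
        case top
        then show ?thesis using that[of 0] by simp
      qed
      then show "x \<in> (\<Union>n. Cn n)" using x by (auto simp: Cn_def intro: less_imp_le)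
    qed
  qed (auto simp: Cn_def)
  have inc: "incseq Cn"
  proof (rule incseq_SucI)
    fix n
    have "1 / of_nat (Suc (Suc n)) \<le> (1 / of_nat (Suc n) :: ennreal)"
    proof -
      have "ennreal (1 / real (Suc (Suc n))) \<le> ennreal (1 / real (Suc n))"
        by (intro ennreal_leI) (simp add: frac_le)
      then show ?thesis
        by (metis divide_ennreal ennreal_1 ennreal_of_nat_eq_real_of_nat of_nat_0_less_iff zero_less_Suc zero_le_one)
    qed
    then show "Cn n \<subseteq> Cn (Suc n)" by (auto simp: Cn_def)
  qed
  have "emeasure N C = (SUP n. emeasure N (Cn n))"
    using SUP_emeasure_incseq[of Cn N] Cn N(2) inc UCn by (simp add: image_subset_iff)
  also have "\<dots> \<le> (SUP n. emeasure M (Cn n))"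
    by (intro SUP_mono) (use NM_Cn in auto)
  also have "\<dots> = emeasure M C"
    using SUP_emeasure_incseq[of Cn M] Cn M(2) inc UCn by (simp add: image_subset_iff)
  finally have C_le: "measure N C \<le> measure M C"
    by (simp add: M.emeasure_eq_measure N.emeasure_eq_measure)
  \<comment> \<open>\<open>N\<close> has no more mass than \<open>M\<close> on \<open>C\<close>, but
    at least as much on \<open>C - A\<close>, hence no more on \<open>C \<inter> A\<close>. The rest
    of \<open>A\<close> lies where \<open>M\<close> dominates.\<close>
  have "measure M (C - A) \<le> measure N (C - A)"
    using leC[of "C - A"] C A by (simp add: M.emeasure_eq_measure N.emeasure_eq_measure)
  moreover have "measure N (A - C) \<le> measure M (A - C)"
    using leH[of "A - C"] C A sets.sets_into_space[OF A] by (auto simp: M.emeasure_eq_measure N.emeasure_eq_measure)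
  moreover have "measure P C = measure P (C \<inter> A) + measure P (C - A)"
    "measure P A = measure P (C \<inter> A) + measure P (A - C)" if "sets P = sets S" "finite_measure P" for P
  proof -
    interpret P: finite_measure P by fact
    show "measure P C = measure P (C \<inter> A) + measure P (C - A)"
      "measure P A = measure P (C \<inter> A) + measure P (A - C)"
      using A C that
      by (subst P.finite_measure_Union[symmetric]; auto intro!: arg_cong[where f="measure P"])+
  qed
  ultimately have "measure N A \<le> measure M A"
    using C_le M(2) N(2) M.finite_measure_axioms N.finite_measure_axioms by (smt (verit, best))
  then show ?thesis by (simp add: M.emeasure_eq_measure N.emeasure_eq_measure)
qed

text \<open>The Hahn set \<open>Y\<close> may or may not contain \<open>x0\<close>, and the two
  measures exchange roles accordingly. A one-sided inequality on all sets is an equality, because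
  both masses are 1 and complements reverse it.\<close>

lemma invariant_prob_unique:
  fixes K :: "'s \<Rightarrow> 's set \<Rightarrow> ennreal"
  assumes M: "prob_space M" "sets M = sets S" and N: "prob_space N" "sets N = sets S"
    and K: "\<And>A. A \<in> sets S \<Longrightarrow> (\<lambda>x. K x A) \<in> borel_measurable S"
    and sub: "\<And>x A B. x \<in> space S \<Longrightarrow> A \<in> sets S \<Longrightarrow> B \<in> sets S \<Longrightarrow> A \<inter> B = {} \<Longrightarrow> K x A + K x B \<le> 1"
    and x0: "{x0} \<in> sets S" and pos: "\<And>x. x \<in> space S \<Longrightarrow> 0 < K x {x0}"
    and invM: "\<And>A. A \<in> sets S \<Longrightarrow> (\<integral>\<^sup>+ x. K x A \<partial>M) = emeasure M A"
    and invN: "\<And>A. A \<in> sets S \<Longrightarrow> (\<integral>\<^sup>+ x. K x A \<partial>N) = emeasure N A"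
  shows "M = N"
proof -
  interpret M: prob_space M by fact
  interpret N: prob_space N by fact
  obtain Y where Y: "Y \<in> sets S"
      "\<And>X. X \<in> sets S \<Longrightarrow> X \<subseteq> Y \<Longrightarrow> emeasure N X \<le> emeasure M X"
      "\<And>X. X \<in> sets S \<Longrightarrow> X \<inter> Y = {} \<Longrightarrow> emeasure M X \<le> emeasure N X"
    using finite_unsigned_Hahn_decomposition[of M N] M N
    by (metis M.finite_measure_axioms N.finite_measure_axioms)
  have "(\<forall>A\<in>sets S. emeasure N A \<le> emeasure M A) \<or> (\<forall>A\<in>sets S. emeasure M A \<le> emeasure N A)"
  proof (cases "x0 \<in> Y")
    case True
    have "emeasure N A \<le> emeasure M A" if "A \<in> sets S" for A
      by (rule invariant_prob_le[OF M N K sub x0 pos invM invN, where C="space S - Y"])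
        (use True Y(1) that sets.sets_into_space[OF Y(1)] in \<open>auto simp: double_diff intro!: Y(2,3)\<close>)
    then show ?thesis by auto
  next
    case False
    have "emeasure M A \<le> emeasure N A" if "A \<in> sets S" for A
      by (rule invariant_prob_le[OF N M K sub x0 pos invN invM, where C=Y])
        (use False Y that in auto)
    then show ?thesis by auto
  qed
  moreover have "emeasure P A = emeasure R A"
    if P: "prob_space P" "sets P = sets S" and R: "prob_space R" "sets R = sets S"
      and le: "\<forall>A\<in>sets S. emeasure P A \<le> emeasure R A" and A: "A \<in> sets S" for P R A
  proof -
    interpret P: prob_space P by fact
    interpret R: prob_space R by fact
    have "measure P A \<le> measure R A" "measure P (space S - A) \<le> measure R (space S - A)"
      using le A by (auto simp: P.emeasure_eq_measure R.emeasure_eq_measure)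
    moreover have "measure P (space S - A) = 1 - measure P A" "measure R (space S - A) = 1 - measure R A"
      using P.prob_compl[of A] R.prob_compl[of A] A P(2) R(2)
      by (auto simp: sets_eq_imp_space_eq[OF P(2)] sets_eq_imp_space_eq[OF R(2)])
    ultimately show ?thesis by (simp add: P.emeasure_eq_measure R.emeasure_eq_measure)
  qed
  ultimately have "emeasure M A = emeasure N A" if "A \<in> sets S" for A
    using M N that by metis
  then show ?thesis
    using M(2) N(2) by (intro measure_eqI) auto
qed

section \<open>Stationary distributions of jump processes\<close>

context rate_kernel
begin

lemma measurable_jump_trans_state [measurable]:
  assumes "A \<in> sets S"
  shows "(\<lambda>x. jump_trans Q t x A) \<in> borel_measurable S"
  using measurable_compose[OF measurable_Pair1' measurable_jump_trans[OF assms], of t] by simp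

lemma measurable_jump_trans_upto_state:
  assumes "A \<in> sets S"
  shows "(\<lambda>x. jump_trans_upto Q n t x A) \<in> borel_measurable S"
  using measurable_compose[OF measurable_Pair1' measurable_jump_trans_upto[OF assms], of t] by simp

lemma measurable_jump_trans_upto_integral:
  assumes A: "A \<in> sets S" and x: "x \<in> space S"
  shows "(\<lambda>s. \<integral>\<^sup>+ y. jump_trans_upto Q n s y A \<partial>Q x) \<in> borel_measurable borel"
  by (rule measurable_nn_integral_kernel[where g="\<lambda>_. x"]) (use measurable_jump_trans_upto[OF A] x in auto)

section \<open>The transition function: backward equation and bounds\<close>

lemma jump_trans_upto_mono: "incseq (\<lambda>n. jump_trans_upto Q n t x A)"
proof (rule incseq_SucI)
  show "jump_trans_upto Q n t x A \<le> jump_trans_upto Q (Suc n) t x A" for n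
    by (induction n arbitrary: t x)
      (auto intro!: add_left_mono nn_integral_mono mult_right_mono mult_left_mono)
qed

text \<open>Monotone convergence in the number of jumps, inside the integral over \<open>Q x\<close>
  and inside the time integral.\<close>

lemma jump_trans_backward:
  assumes A: "A \<in> sets S" and x: "x \<in> space S"
  shows "jump_trans Q t x A = ennreal (exp (- total_rate Q x * t)) * indicator A x +
     (\<integral>\<^sup>+ s\<in>{0..t}. ennreal (exp (- total_rate Q x * s)) *
        (\<integral>\<^sup>+ y. jump_trans Q (t - s) y A \<partial>Q x) \<partial>lborel)"
proof -
  let ?F = "\<lambda>n s. ennreal (exp (- total_rate Q x * s)) *
        (\<integral>\<^sup>+ y. jump_trans_upto Q n (t - s) y A \<partial>Q x) * indicator {0..t} s"
  have "jump_trans Q t x A = (SUP n. jump_trans_upto Q (Suc n) t x A)"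
    unfolding jump_trans_def
    by (intro antisym SUP_mono) (use incseq_SucD[OF jump_trans_upto_mono] in blast)+
  also have "\<dots> = ennreal (exp (- total_rate Q x * t)) * indicator A x + (SUP n. \<integral>\<^sup>+ s. ?F n s \<partial>lborel)"
    by (simp add: ennreal_SUP_add_right)
  also have "(SUP n. \<integral>\<^sup>+ s. ?F n s \<partial>lborel) = (\<integral>\<^sup>+ s. (SUP n. ?F n s) \<partial>lborel)"
  proof (rule nn_integral_monotone_convergence_SUP[symmetric])
    show "incseq ?F"
      by (intro incseq_SucI le_funI mult_right_mono mult_left_mono nn_integral_mono
          incseq_SucD[OF jump_trans_upto_mono]) auto
    show "?F n \<in> borel_measurable lborel" for n
      using measurable_compose[OF _ measurable_jump_trans_upto_integral[OF A x], of "\<lambda>s. t - s" borel n] by measurable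
  qed
  also have "\<dots> = (\<integral>\<^sup>+ s\<in>{0..t}. ennreal (exp (- total_rate Q x * s)) *
        (\<integral>\<^sup>+ y. jump_trans Q (t - s) y A \<partial>Q x) \<partial>lborel)"
  proof (intro nn_integral_cong)
    fix s
    have "(\<integral>\<^sup>+ y. jump_trans Q (t - s) y A \<partial>Q x) = (SUP n. \<integral>\<^sup>+ y. jump_trans_upto Q n (t - s) y A \<partial>Q x)"
      unfolding jump_trans_def
      by (rule nn_integral_monotone_convergence_SUP)
        (use jump_trans_upto_mono measurable_jump_trans_upto_state[OF A] in
          \<open>auto simp: incseq_def le_fun_def borel_measurable_Q[OF x]\<close>)
    then show "(SUP n. ?F n s) = ennreal (exp (- total_rate Q x * s)) *
        (\<integral>\<^sup>+ y. jump_trans Q (t - s) y A \<partial>Q x) * indicator {0..t} s"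
      by (simp add: SUP_mult_left_ennreal SUP_mult_right_ennreal)
  qed
  finally show ?thesis .
qed

text \<open>Two disjoint sets are treated together because the uniqueness argument compares the mass
  in \<open>C\<close> with the mass at \<open>x0\<close>. In the induction the no-jump term counts
  for at most one of them, and a first jump occurs by time \<open>t\<close> with probability
  \<open>1 - exp (- total_rate Q x * t)\<close>.\<close>

lemma jump_trans_upto_disjoint_le_1:
  assumes A: "A \<in> sets S" and B: "B \<in> sets S" and AB: "A \<inter> B = {}" and x: "x \<in> space S" and t: "0 \<le> t"
  shows "jump_trans_upto Q n t x A + jump_trans_upto Q n t x B \<le> 1"
  using x t
proof (induction n arbitrary: t x)
  case (Suc n)
  note q = total_rate_nonneg[of x]
  let ?I = "\<lambda>A s. \<integral>\<^sup>+ y. jump_trans_upto Q n (t - s) y A \<partial>Q x"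
  let ?e = "\<lambda>s. ennreal (exp (- total_rate Q x * s))"
  have [measurable]: "?I C \<in> borel_measurable borel" if "C \<in> sets S" for C
    using measurable_compose[OF _ measurable_jump_trans_upto_integral[OF that Suc.prems(1)], of "\<lambda>s. t - s" borel n] by measurable
  have "(\<integral>\<^sup>+ s\<in>{0..t}. ?e s * ?I A s \<partial>lborel) + (\<integral>\<^sup>+ s\<in>{0..t}. ?e s * ?I B s \<partial>lborel)
      = (\<integral>\<^sup>+ s. ?e s * ?I A s * indicator {0..t} s + ?e s * ?I B s * indicator {0..t} s \<partial>lborel)"
    by (rule nn_integral_add[symmetric]) (use A B in measurable)
  also have "\<dots> \<le> (\<integral>\<^sup>+ s\<in>{0..t}. ennreal (total_rate Q x * exp (- total_rate Q x * (s - 0))) \<partial>lborel)"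
  proof (rule nn_integral_mono)
    fix s
    have "?I A s + ?I B s \<le> ennreal (total_rate Q x)" if s: "s \<in> {0..t}"
    proof -
      have "?I A s + ?I B s = (\<integral>\<^sup>+ y. jump_trans_upto Q n (t - s) y A + jump_trans_upto Q n (t - s) y B \<partial>Q x)"
        using A B measurable_jump_trans_upto_state
        by (intro nn_integral_add[symmetric]) (auto simp: borel_measurable_Q[OF Suc.prems(1)])
      also have "\<dots> \<le> (\<integral>\<^sup>+ y. 1 \<partial>Q x)"
        using s Suc.IH space_Q[OF Suc.prems(1)] by (intro nn_integral_mono) auto
      also have "\<dots> = ennreal (total_rate Q x)"
        using Suc.prems by (simp add: space_Q emeasure_space_Q)
      finally show ?thesis .
    qed
    then have "?e s * (?I A s + ?I B s) \<le> ?e s * ennreal (total_rate Q x)" if "s \<in> {0..t}"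
      using that by (intro mult_left_mono) auto
    then show "?e s * ?I A s * indicator {0..t} s + ?e s * ?I B s * indicator {0..t} s
       \<le> ennreal (total_rate Q x * exp (- total_rate Q x * (s - 0))) * indicator {0..t} s"
      using q by (auto simp: indicator_def distrib_left ennreal_mult mult.commute)
  qed
  also have "\<dots> = ennreal (1 - exp (- total_rate Q x * t))"
    using nn_integral_exp_Icc[OF q Suc.prems(2)] by simp
  finally have I: "(\<integral>\<^sup>+ s\<in>{0..t}. ?e s * ?I A s \<partial>lborel) + (\<integral>\<^sup>+ s\<in>{0..t}. ?e s * ?I B s \<partial>lborel)
     \<le> ennreal (1 - exp (- total_rate Q x * t))" .
  have "?e t * indicator A x + ?e t * indicator B x \<le> ?e t"
    using AB by (auto simp: indicator_def)
  then have "(?e t * indicator A x + ?e t * indicator B x) + ((\<integral>\<^sup>+ s\<in>{0..t}. ?e s * ?I A s \<partial>lborel) + (\<integral>\<^sup>+ s\<in>{0..t}. ?e s * ?I B s \<partial>lborel))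
     \<le> ?e t + ennreal (1 - exp (- total_rate Q x * t))"
    using I by (rule add_mono)
  also have "\<dots> = 1"
    using q Suc.prems(2) by (subst ennreal_plus[symmetric]) auto
  finally show ?case by (simp add: ac_simps)
qed simp

lemma jump_trans_disjoint_le_1:
  assumes "A \<in> sets S" "B \<in> sets S" "A \<inter> B = {}" "x \<in> space S" "0 \<le> t"
  shows "jump_trans Q t x A + jump_trans Q t x B \<le> 1"
proof -
  have "jump_trans Q t x A + jump_trans Q t x B = (SUP n. jump_trans_upto Q n t x A + jump_trans_upto Q n t x B)"
    unfolding jump_trans_def by (rule ennreal_SUP_add[symmetric]; rule jump_trans_upto_mono)
  also have "\<dots> \<le> 1"
    by (intro SUP_least jump_trans_upto_disjoint_le_1 assms)
  finally show ?thesis .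
qed

lemma jump_trans_le_1:
  assumes "A \<in> sets S" "x \<in> space S" "0 \<le> t"
  shows "jump_trans Q t x A \<le> 1"
  using jump_trans_disjoint_le_1[of A "{}" x t] assms by (metis add_increasing2 inf_bot_right order_trans sets.empty_sets zero_le le_iff_add)

text \<open>Keep only the paths whose first jump goes to \<open>B\<close> by time
  \<open>a / 2\<close>. The time left then lies between \<open>a / 2\<close> and 1, and the
  exponential factor is at least its value at time 1.\<close>

lemma jump_trans_upto_lower_bound:
  assumes B: "B \<in> sets S" and x: "x \<in> space S" and a: "0 < a" "a \<le> t" "t \<le> 1"
    and le: "\<And>s y. a / 2 \<le> s \<Longrightarrow> s \<le> 1 \<Longrightarrow> y \<in> B \<Longrightarrow> c \<le> jump_trans_upto Q n s y A"
  shows "ennreal (a / 2 * exp (- total_rate Q x)) * (c * emeasure (Q x) B) \<le> jump_trans_upto Q (Suc n) t x A"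
proof -
  have e: "ennreal (a / 2 * exp (- total_rate Q x)) = ennreal (exp (- total_rate Q x)) * ennreal (a / 2)"
    using a by (subst ennreal_mult[symmetric]) (auto simp: mult.commute)
  have "ennreal (a / 2 * exp (- total_rate Q x)) * (c * emeasure (Q x) B)
      = (\<integral>\<^sup>+ s. (ennreal (exp (- total_rate Q x)) * (c * emeasure (Q x) B)) * indicator {0..a / 2} s \<partial>lborel)"
    unfolding e by (subst nn_integral_cmult_indicator) (use a in \<open>auto simp: ac_simps\<close>)
  also have "\<dots> \<le> (\<integral>\<^sup>+ s\<in>{0..t}. ennreal (exp (- total_rate Q x * s)) *
        (\<integral>\<^sup>+ y. jump_trans_upto Q n (t - s) y A \<partial>Q x) \<partial>lborel)"
  proof (rule nn_integral_mono)
    fix s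
    show "(ennreal (exp (- total_rate Q x)) * (c * emeasure (Q x) B)) * indicator {0..a / 2} s
        \<le> ennreal (exp (- total_rate Q x * s)) * (\<integral>\<^sup>+ y. jump_trans_upto Q n (t - s) y A \<partial>Q x) * indicator {0..t} s"
    proof (cases "s \<in> {0..a / 2}")
      case True
      have "c * emeasure (Q x) B = (\<integral>\<^sup>+ y. c * indicator B y \<partial>Q x)"
        using B x by (subst nn_integral_cmult_indicator) (auto simp: sets_Q)
      also have "\<dots> \<le> (\<integral>\<^sup>+ y. jump_trans_upto Q n (t - s) y A \<partial>Q x)"
        using True a le[of "t - s"] by (intro nn_integral_mono) (auto simp: indicator_def)
      finally have 1: "c * emeasure (Q x) B \<le> (\<integral>\<^sup>+ y. jump_trans_upto Q n (t - s) y A \<partial>Q x)" .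
      have "total_rate Q x * s \<le> total_rate Q x * 1"
        using True a by (intro mult_left_mono total_rate_nonneg) auto
      then have "ennreal (exp (- total_rate Q x)) \<le> ennreal (exp (- total_rate Q x * s))"
        by (intro ennreal_leI) simp
      then show ?thesis using True a 1 by (auto intro: mult_mono)
    qed simp
  qed
  also have "\<dots> \<le> jump_trans_upto Q (Suc n) t x A" by simp
  finally show ?thesis .
qed

text \<open>Integrating the backward equation against \<open>\<pi>\<close>, the balance equation makes the gain and loss
  terms cancel; \<open>finite\<close> is what allows the cancellation.\<close>
lemma stationary_distributionI:
  assumes \<pi>: "prob_space \<pi>" "sets \<pi> = sets S"
    and finite: "(\<integral>\<^sup>+ x. ennreal (total_rate Q x) \<partial>\<pi>) < \<infinity>"
    and balance: "\<And>f. f \<in> borel_measurable S \<Longrightarrow>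
        (\<integral>\<^sup>+ x. (\<integral>\<^sup>+ y. f y \<partial>Q x) \<partial>\<pi>) = (\<integral>\<^sup>+ x. ennreal (total_rate Q x) * f x \<partial>\<pi>)"
  shows "stationary_distribution S Q \<pi>"
  unfolding stationary_distribution_def
proof (intro conjI \<pi> allI impI ballI)
  fix t :: real and A assume t: "0 \<le> t" and A: "A \<in> sets S"
  interpret prob_space \<pi> by fact
  have space: "space \<pi> = space S" using \<pi>(2) by (rule sets_eq_imp_space_eq)
  note bm = measurable_cong_sets[OF \<pi>(2) refl]
  note bm2 = measurable_cong_sets[OF sets_pair_measure_cong[OF refl \<pi>(2)] refl]
  note P = measurable_jump_trans[OF A]
  have P' [measurable]: "(\<lambda>(s, x). jump_trans Q s x A) \<in> borel_measurable (borel \<Otimes>\<^sub>M \<pi>)"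
    unfolding bm2 by (rule P)
  have q [measurable]: "total_rate Q \<in> borel_measurable \<pi>"
    unfolding bm by (rule measurable_total_rate)
  let ?h = "\<lambda>x s. \<integral>\<^sup>+ y. jump_trans Q s y A \<partial>Q x"
  have h: "(\<lambda>(s, x). ?h x s) \<in> borel_measurable (borel \<Otimes>\<^sub>M S)"
  proof -
    have "(\<lambda>z. (fst (fst z), snd z)) \<in> measurable ((borel \<Otimes>\<^sub>M S) \<Otimes>\<^sub>M S) (borel \<Otimes>\<^sub>M S)" by measurable
    from measurable_compose[OF this P]
    have "(\<lambda>v. \<integral>\<^sup>+ y. jump_trans Q (fst v) y A \<partial>Q (snd v)) \<in> borel_measurable (borel \<Otimes>\<^sub>M S)"
      by (intro measurable_nn_integral_kernel) (auto simp: case_prod_beta')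
    then show ?thesis by (simp add: case_prod_beta')
  qed
  then have h' [measurable]: "(\<lambda>(s, x). ?h x s) \<in> borel_measurable (borel \<Otimes>\<^sub>M \<pi>)"
    unfolding bm2 .
  have integrated: "jump_trans Q t x A + (\<integral>\<^sup>+ s\<in>{0..t}. ennreal (total_rate Q x) * jump_trans Q s x A \<partial>lborel)
      = indicator A x + (\<integral>\<^sup>+ s\<in>{0..t}. ?h x s \<partial>lborel)" if x: "x \<in> space S" for x
  proof (rule duhamel_integrated[OF total_rate_nonneg t])
    show "?h x \<in> borel_measurable borel"
      using measurable_compose[OF measurable_Pair2'[OF x] h] by simp
  qed (rule jump_trans_backward[OF A x])
  have fubini: "(\<integral>\<^sup>+ x. (\<integral>\<^sup>+ s\<in>{0..t}. g s x \<partial>lborel) \<partial>\<pi>) = (\<integral>\<^sup>+ s\<in>{0..t}. (\<integral>\<^sup>+ x. g s x \<partial>\<pi>) \<partial>lborel)"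
    if g [measurable]: "(\<lambda>(s, x). g s x) \<in> borel_measurable (borel \<Otimes>\<^sub>M \<pi>)" for g :: "real \<Rightarrow> _ \<Rightarrow> ennreal"
  proof -
    interpret pair_sigma_finite lborel \<pi> ..
    have gs: "g s \<in> borel_measurable \<pi>" for s
      using measurable_compose[OF measurable_Pair1' g, of s] by simp
    have "(\<integral>\<^sup>+ x. (\<integral>\<^sup>+ s\<in>{0..t}. g s x \<partial>lborel) \<partial>\<pi>) = (\<integral>\<^sup>+ s. (\<integral>\<^sup>+ x. g s x * indicator {0..t} s \<partial>\<pi>) \<partial>lborel)"
      by (rule Fubini') (use g in measurable)
    then show ?thesis using gs by (simp add: nn_integral_multc)
  qed
  let ?G = "\<integral>\<^sup>+ s\<in>{0..t}. (\<integral>\<^sup>+ x. ennreal (total_rate Q x) * jump_trans Q s x A \<partial>\<pi>) \<partial>lborel"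
  have [measurable]: "(\<lambda>x. jump_trans Q t x A) \<in> borel_measurable \<pi>" "A \<in> sets \<pi>"
    unfolding bm using A \<pi>(2) measurable_jump_trans_state by auto
  have meas1 [measurable]: "(\<lambda>x. \<integral>\<^sup>+ s\<in>{0..t}. ennreal (total_rate Q x) * jump_trans Q s x A \<partial>lborel) \<in> borel_measurable \<pi>"
    by (rule lborel.borel_measurable_nn_integral) (use measurable_compose[OF measurable_pair_swap' P'] in \<open>simp add: case_prod_beta'\<close>)
  have meas2 [measurable]: "(\<lambda>x. \<integral>\<^sup>+ s\<in>{0..t}. ?h x s \<partial>lborel) \<in> borel_measurable \<pi>"
    by (rule lborel.borel_measurable_nn_integral) (use measurable_compose[OF measurable_pair_swap' h'] in \<open>simp add: case_prod_beta'\<close>)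
  have "(\<integral>\<^sup>+ x. jump_trans Q t x A \<partial>\<pi>) + ?G
      = (\<integral>\<^sup>+ x. jump_trans Q t x A + (\<integral>\<^sup>+ s\<in>{0..t}. ennreal (total_rate Q x) * jump_trans Q s x A \<partial>lborel) \<partial>\<pi>)"
    by (subst nn_integral_add) (auto simp: fubini)
  also have "\<dots> = (\<integral>\<^sup>+ x. indicator A x + (\<integral>\<^sup>+ s\<in>{0..t}. ?h x s \<partial>lborel) \<partial>\<pi>)"
    by (intro nn_integral_cong integrated) (simp add: space)
  also have "\<dots> = emeasure \<pi> A + (\<integral>\<^sup>+ s\<in>{0..t}. (\<integral>\<^sup>+ x. ?h x s \<partial>\<pi>) \<partial>lborel)"
    by (subst nn_integral_add) (auto simp: fubini)
  \<comment> \<open>Balance is applied for each \<open>s\<close> to the test function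
    \<open>\<lambda>x. jump_trans Q s x A\<close>.\<close>
  also have "(\<integral>\<^sup>+ s\<in>{0..t}. (\<integral>\<^sup>+ x. ?h x s \<partial>\<pi>) \<partial>lborel) = ?G"
    by (simp add: balance measurable_jump_trans_state[OF A])
  finally have eq: "?G + (\<integral>\<^sup>+ x. jump_trans Q t x A \<partial>\<pi>) = ?G + emeasure \<pi> A" by (simp add: add.commute)
  \<comment> \<open>Transition probabilities are at most 1, so \<open>?G\<close> is bounded by
    \<open>t\<close> times the mean jump rate.\<close>
  have "?G \<le> (\<integral>\<^sup>+ s\<in>{0..t}. (\<integral>\<^sup>+ x. ennreal (total_rate Q x) \<partial>\<pi>) \<partial>lborel)"
  proof (rule nn_integral_mono)
    fix s
    have "(\<integral>\<^sup>+ x. ennreal (total_rate Q x) * jump_trans Q s x A \<partial>\<pi>) \<le> (\<integral>\<^sup>+ x. ennreal (total_rate Q x) \<partial>\<pi>)" if "0 \<le> s"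
      using jump_trans_le_1[OF A _ that] by (intro nn_integral_mono) (auto simp: space intro: mult_left_le)
    then show "(\<integral>\<^sup>+ x. ennreal (total_rate Q x) * jump_trans Q s x A \<partial>\<pi>) * indicator {0..t} s
        \<le> (\<integral>\<^sup>+ x. ennreal (total_rate Q x) \<partial>\<pi>) * indicator {0..t} s"
      by (auto simp: indicator_def)
  qed
  also have "\<dots> = (\<integral>\<^sup>+ x. ennreal (total_rate Q x) \<partial>\<pi>) * ennreal t"
    using t by (simp add: nn_integral_cmult_indicator)
  also have "\<dots> < \<infinity>" using finite by (simp add: ennreal_mult_less_top)
  finally show "(\<integral>\<^sup>+ x. jump_trans Q t x A \<partial>\<pi>) = emeasure \<pi> A"
    using eq by (auto simp: ennreal_add_left_cancel)
qed

lemma stationary_distribution_unique: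
  assumes x0: "{x0} \<in> sets S" and pos: "\<And>x. x \<in> space S \<Longrightarrow> 0 < jump_trans Q 1 x {x0}"
    and M: "stationary_distribution S Q M" and N: "stationary_distribution S Q N"
  shows "M = N"
proof (rule invariant_prob_unique[where K="jump_trans Q 1"])
  show "prob_space M" "sets M = sets S" "prob_space N" "sets N = sets S"
    using M N by (auto simp: stationary_distribution_def)
  show "(\<integral>\<^sup>+ x. jump_trans Q 1 x A \<partial>M) = emeasure M A" "(\<integral>\<^sup>+ x. jump_trans Q 1 x A \<partial>N) = emeasure N A"
    if "A \<in> sets S" for A
    using M N that by (auto simp: stationary_distribution_def)
qed (use x0 pos jump_trans_disjoint_le_1 measurable_jump_trans_state in auto)

text \<open>The stationary measure is the expected occupation time of an excursion from \<open>x\<^sub>0\<close>: the kernel \<open>J\<close>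
  is the embedded jump chain killed when it enters \<open>x\<^sub>0\<close>, \<open>\<kappa> n\<close> is its law after \<open>n\<close> steps, and
  \<open>V\<close> bounds the expected number of jumps before the return to \<open>x\<^sub>0\<close>.\<close>
lemma stationary_distribution_exists:
  fixes V :: "'s \<Rightarrow> ennreal"
  assumes x0: "x0 \<in> space S" "{x0} \<in> sets S"
    and c: "0 < c" "\<And>x. x \<in> space S \<Longrightarrow> c \<le> total_rate Q x"
    and V [measurable]: "V \<in> borel_measurable S" and V_x0: "V x0 = 0"
    and V_finite: "(\<integral>\<^sup>+ y. V y \<partial>Q x0) < \<infinity>"
    and drift: "\<And>x. x \<in> space S \<Longrightarrow> x \<noteq> x0 \<Longrightarrow>
        (\<integral>\<^sup>+ y. V y \<partial>Q x) + ennreal (total_rate Q x) \<le> ennreal (total_rate Q x) * V x"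
  shows "\<exists>\<pi>. stationary_distribution S Q \<pi>"
proof -
  let ?q = "total_rate Q"
  let ?E = "space S - {x0}"
  have E: "?E \<in> sets S" using x0 by auto
  have q_pos: "0 < ?q x" if "x \<in> space S" for x using c(1) c(2)[OF that] by linarith
  have inv_q: "ennreal (1 / ?q x) * ennreal (?q x) = 1" if "x \<in> space S" for x
    using q_pos[OF that] by (subst ennreal_mult[symmetric]) auto
  have [measurable]: "(\<lambda>x. ennreal (1 / ?q x)) \<in> borel_measurable S" by measurable
  \<comment> \<open>The normalised \<open>Q x\<close> without the mass that falls on
    \<open>x0\<close>; its iterates see the jump chain only before the return.\<close>
  define J where "J x = density (scale_measure (ennreal (1 / ?q x)) (Q x)) (indicator ?E)" for x
  have emeasure_J: "emeasure (J x) A = ennreal (1 / ?q x) * emeasure (Q x) (?E \<inter> A)"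
    if "x \<in> space S" "A \<in> sets S" for x A
    unfolding J_def using that E by (subst emeasure_restricted) (auto simp: sets_Q)
  have sets_J: "sets (J x) = sets S" if "x \<in> space S" for x
    using sets_Q[OF that] by (simp add: J_def)
  have J [measurable]: "J \<in> measurable S (subprob_algebra S)"
  proof (rule measurable_subprob_algebra)
    fix x assume x: "x \<in> space S"
    show "sets (J x) = sets S" using sets_J[OF x] .
    show "subprob_space (J x)"
    proof (rule subprob_spaceI)
      have sp: "space (J x) = space S" using sets_J[OF x] by (rule sets_eq_imp_space_eq)
      show "space (J x) \<noteq> {}" using x sp by auto
      have "emeasure (Q x) (?E \<inter> space S) \<le> ennreal (?q x)"
        using x by (subst emeasure_space_Q[symmetric]) (auto intro!: emeasure_mono simp: sets_Q)
      then have "ennreal (1 / ?q x) * emeasure (Q x) (?E \<inter> space S) \<le> ennreal (1 / ?q x) * ennreal (?q x)"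
        by (intro mult_left_mono) auto
      then show "emeasure (J x) (space (J x)) \<le> 1"
        using x by (simp add: sp emeasure_J inv_q)
    qed
  next
    fix A assume A: "A \<in> sets S"
    have "(\<lambda>x. ennreal (1 / ?q x) * emeasure (Q x) (?E \<inter> A)) \<in> borel_measurable S"
      using measurable_emeasure_Q[of "?E \<inter> A"] E A by measurable
    then show "(\<lambda>x. emeasure (J x) A) \<in> borel_measurable S"
      by (rule measurable_cong[THEN iffD1, rotated]) (simp add: emeasure_J A)
  qed
  have nn_J: "(\<integral>\<^sup>+ y. f y \<partial>J x) = ennreal (1 / ?q x) * (\<integral>\<^sup>+ y\<in>?E. f y \<partial>Q x)"
    if x: "x \<in> space S" and f: "f \<in> borel_measurable S" for x f
  proof -
    have [measurable]: "f \<in> borel_measurable (Q x)" "?E \<in> sets (Q x)"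
      using x f E by (auto simp: borel_measurable_Q sets_Q)
    have "(\<integral>\<^sup>+ y. f y \<partial>J x) = (\<integral>\<^sup>+ y. indicator ?E y * f y \<partial>scale_measure (ennreal (1 / ?q x)) (Q x))"
      unfolding J_def by (rule nn_integral_density) auto
    then show ?thesis by (subst (asm) nn_integral_scale_measure) (auto simp: mult.commute)
  qed
  define \<kappa> where "\<kappa> = rec_nat (return S x0) (\<lambda>_ M. M \<bind> J)"
  have \<kappa>_0: "\<kappa> 0 = return S x0" and \<kappa>_Suc: "\<kappa> (Suc n) = \<kappa> n \<bind> J" for n
    by (simp_all add: \<kappa>_def)
  have \<kappa>_in: "\<kappa> n \<in> space (subprob_algebra S)" for n
  proof (induction n)
    case 0
    show ?case using x0 by (simp add: \<kappa>_0 space_subprob_algebra prob_space_return prob_space_imp_subprob_space)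
  next
    case (Suc n)
    then have s: "subprob_space (\<kappa> n)" "sets (\<kappa> n) = sets S" by (auto simp: space_subprob_algebra)
    have J': "J \<in> measurable (\<kappa> n) (subprob_algebra S)" using J by (simp add: measurable_cong_sets[OF s(2) refl])
    have "space (\<kappa> n) \<noteq> {}" using s(1) by (rule subprob_space.subprob_not_empty)
    with s show ?case
      by (simp add: \<kappa>_Suc space_subprob_algebra subprob_space_bind[OF s(1) J'] sets_bind_measurable[OF J'])
  qed
  have sets_\<kappa>: "sets (\<kappa> n) = sets S" for n using \<kappa>_in[of n] by (simp add: space_subprob_algebra)
  have space_\<kappa>: "space (\<kappa> n) = space S" for n using sets_\<kappa> by (rule sets_eq_imp_space_eq)
  have \<kappa> [measurable]: "\<kappa> \<in> measurable (count_space UNIV) (subprob_algebra S)"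
    using \<kappa>_in by (auto simp: measurable_count_space_eq1)
  have J\<kappa>: "J \<in> measurable (\<kappa> n) (subprob_algebra S)" for n
    using J by (simp add: measurable_cong_sets[OF sets_\<kappa> refl])
  have nn_\<kappa>_Suc: "(\<integral>\<^sup>+ x. f x \<partial>\<kappa> (Suc n)) = (\<integral>\<^sup>+ x. (\<integral>\<^sup>+ y. f y \<partial>J x) \<partial>\<kappa> n)"
    if "f \<in> borel_measurable S" for f n
    unfolding \<kappa>_Suc by (rule nn_integral_bind[OF that J\<kappa>])
  \<comment> \<open>Binding the counting measure of the step numbers to \<open>\<kappa>\<close> sums
    the laws: the expected number of visits to a set during an excursion.\<close>
  define \<nu> where "\<nu> = count_space UNIV \<bind> \<kappa>"
  have sets_\<nu>: "sets \<nu> = sets S"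
    unfolding \<nu>_def by (rule sets_bind_measurable[OF \<kappa>]) simp
  have space_\<nu>: "space \<nu> = space S" using sets_\<nu> by (rule sets_eq_imp_space_eq)
  note bm_\<nu> = measurable_cong_sets[OF sets_\<nu> refl]
  have nn_\<nu>: "(\<integral>\<^sup>+ x. f x \<partial>\<nu>) = (\<Sum>n. \<integral>\<^sup>+ x. f x \<partial>\<kappa> n)" if "f \<in> borel_measurable S" for f
    unfolding \<nu>_def by (subst nn_integral_bind[OF that \<kappa>]) (rule nn_integral_count_space_nat)
  have J_meas: "(\<lambda>x. \<integral>\<^sup>+ y. f y \<partial>J x) \<in> borel_measurable S" if "f \<in> borel_measurable S" for f
    using measurable_compose[OF J nn_integral_measurable_subprob_algebra[OF that]] .
  \<comment> \<open>Splitting off step 0 exhibits \<open>\<nu>\<close> as the point mass at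
    \<open>x0\<close> plus its own image under \<open>J\<close>.\<close>
  have renewal: "(\<integral>\<^sup>+ x. f x \<partial>\<nu>) = f x0 + (\<integral>\<^sup>+ x. (\<integral>\<^sup>+ y. f y \<partial>J x) \<partial>\<nu>)"
    if f: "f \<in> borel_measurable S" for f
  proof -
    have "(\<integral>\<^sup>+ x. f x \<partial>\<nu>) = (\<Sum>n. \<integral>\<^sup>+ x. f x \<partial>\<kappa> (Suc n)) + (\<integral>\<^sup>+ x. f x \<partial>\<kappa> 0)"
      unfolding nn_\<nu>[OF f] using suminf_offset[of "\<lambda>n. \<integral>\<^sup>+ x. f x \<partial>\<kappa> n" 1] by (simp add: summableI)
    then show ?thesis
      using x0 f by (simp add: nn_\<kappa>_Suc nn_\<nu> J_meas \<kappa>_0 nn_integral_return add.commute)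
  qed
  have \<nu>_finite: "emeasure \<nu> (space S) < \<infinity>"
  proof -
    have null: "{x0} \<in> null_sets (\<kappa> (Suc n))" for n
    proof -
      have "emeasure (\<kappa> (Suc n)) {x0} = (\<integral>\<^sup>+ x. emeasure (J x) {x0} \<partial>\<kappa> n)"
        unfolding \<kappa>_Suc by (rule emeasure_bind[OF _ J\<kappa> x0(2)]) (use x0 space_\<kappa> in auto)
      also have "\<dots> = (\<integral>\<^sup>+ x. 0 \<partial>\<kappa> n)"
        by (intro nn_integral_cong) (simp add: space_\<kappa> emeasure_J x0)
      finally show ?thesis using x0 by (simp add: null_sets_def sets_\<kappa>)
    qed
    \<comment> \<open>Killing at \<open>x0\<close> changes nothing here because \<open>V\<close>
      vanishes there.\<close>
    have J_V: "(\<integral>\<^sup>+ y. V y \<partial>J x) = ennreal (1 / ?q x) * (\<integral>\<^sup>+ y. V y \<partial>Q x)" if "x \<in> space S" for x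
      unfolding nn_J[OF that V]
      by (intro arg_cong2[where f="(*)"] nn_integral_cong refl) (use that V_x0 in \<open>auto simp: space_Q indicator_def\<close>)
    have step: "(\<integral>\<^sup>+ x. V x \<partial>\<kappa> (Suc (Suc n))) + emeasure (\<kappa> (Suc n)) (space S) \<le> (\<integral>\<^sup>+ x. V x \<partial>\<kappa> (Suc n))" for n
    proof -
      have "(\<integral>\<^sup>+ x. V x \<partial>\<kappa> (Suc (Suc n))) + emeasure (\<kappa> (Suc n)) (space S)
         = (\<integral>\<^sup>+ x. (\<integral>\<^sup>+ y. V y \<partial>J x) \<partial>\<kappa> (Suc n)) + (\<integral>\<^sup>+ x. 1 \<partial>\<kappa> (Suc n))"
        by (simp add: nn_\<kappa>_Suc[of V "Suc n"] space_\<kappa>)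
      also have "\<dots> = (\<integral>\<^sup>+ x. (\<integral>\<^sup>+ y. V y \<partial>J x) + 1 \<partial>\<kappa> (Suc n))"
        using J_meas[OF V] by (intro nn_integral_add[symmetric]) (auto simp: measurable_cong_sets[OF sets_\<kappa> refl])
      also have "\<dots> \<le> (\<integral>\<^sup>+ x. V x \<partial>\<kappa> (Suc n))"
      proof (rule nn_integral_mono_AE)
        have "(\<integral>\<^sup>+ y. V y \<partial>J x) + 1 \<le> V x" if x: "x \<in> space S" "x \<noteq> x0" for x
        proof -
          have "(\<integral>\<^sup>+ y. V y \<partial>J x) + 1 = ennreal (1 / ?q x) * ((\<integral>\<^sup>+ y. V y \<partial>Q x) + ennreal (?q x))"
            using x by (simp add: J_V inv_q distrib_left)
          also have "\<dots> \<le> ennreal (1 / ?q x) * (ennreal (?q x) * V x)"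
            by (intro mult_left_mono drift x) simp
          also have "\<dots> = V x" using x by (simp add: mult.assoc[symmetric] inv_q)
          finally show ?thesis .
        qed
        then show "AE x in \<kappa> (Suc n). (\<integral>\<^sup>+ y. V y \<partial>J x) + 1 \<le> V x"
          by (intro AE_mp[OF AE_not_in[OF null[of n]] AE_I2]) (auto simp: space_\<kappa>)
      qed
      finally show ?thesis .
    qed
    \<comment> \<open>Every step survived is paid with one unit of \<open>V\<close>. The account
      opens after the jump out of \<open>x0\<close>, with the finite mean of \<open>V\<close> at
      that moment.\<close>
    have bound: "(\<Sum>i<N. emeasure (\<kappa> (Suc i)) (space S)) + (\<integral>\<^sup>+ x. V x \<partial>\<kappa> (Suc N)) \<le> (\<integral>\<^sup>+ x. V x \<partial>\<kappa> (Suc 0))" for N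
    proof (induction N)
      case (Suc N)
      have "(\<Sum>i<Suc N. emeasure (\<kappa> (Suc i)) (space S)) + (\<integral>\<^sup>+ x. V x \<partial>\<kappa> (Suc (Suc N)))
          = (\<Sum>i<N. emeasure (\<kappa> (Suc i)) (space S)) + ((\<integral>\<^sup>+ x. V x \<partial>\<kappa> (Suc (Suc N))) + emeasure (\<kappa> (Suc N)) (space S))"
        by (simp add: ac_simps)
      also have "\<dots> \<le> (\<Sum>i<N. emeasure (\<kappa> (Suc i)) (space S)) + (\<integral>\<^sup>+ x. V x \<partial>\<kappa> (Suc N))"
        by (intro add_left_mono step)
      finally show ?case using Suc.IH by (rule order_trans)
    qed simp
    have V1: "(\<integral>\<^sup>+ x. V x \<partial>\<kappa> (Suc 0)) = ennreal (1 / ?q x0) * (\<integral>\<^sup>+ y. V y \<partial>Q x0)"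
      using x0 J_meas[OF V] by (simp add: nn_\<kappa>_Suc \<kappa>_0 nn_integral_return J_V)
    have "(\<Sum>n. emeasure (\<kappa> (Suc n)) (space S)) \<le> (\<integral>\<^sup>+ x. V x \<partial>\<kappa> (Suc 0))"
      by (rule suminf_le_const[OF summableI]) (use bound in \<open>meson le_iff_add order_trans\<close>)
    also have "\<dots> < \<infinity>" unfolding V1 using V_finite by (simp add: ennreal_mult_less_top)
    finally have "(\<Sum>n. emeasure (\<kappa> (Suc n)) (space S)) < \<infinity>" .
    moreover have "emeasure \<nu> (space S) = (\<Sum>n. emeasure (\<kappa> n) (space S))"
      using nn_\<nu>[of "\<lambda>_. 1"] by (simp add: space_\<nu> space_\<kappa>)
    then have "emeasure \<nu> (space S) = (\<Sum>n. emeasure (\<kappa> (Suc n)) (space S)) + emeasure (\<kappa> 0) (space S)"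
      using suminf_offset[of "\<lambda>n. emeasure (\<kappa> n) (space S)" 1] by (simp add: summableI)
    moreover have "emeasure (\<kappa> 0) (space S) = 1" using x0 by (simp add: \<kappa>_0)
    ultimately show ?thesis by simp
  qed
  \<comment> \<open>The chance that the next jump leads to \<open>x0\<close>, that is, the mass
    removed in \<open>J\<close>.\<close>
  define r where "r x = ennreal (1 / ?q x) * emeasure (Q x) {x0}" for x
  have r [measurable]: "r \<in> borel_measurable S"
    unfolding r_def using measurable_emeasure_Q[OF x0(2)] by measurable
  have decomp: "ennreal (1 / ?q x) * (\<integral>\<^sup>+ y. f y \<partial>Q x) = (\<integral>\<^sup>+ y. f y \<partial>J x) + r x * f x0"
    if x: "x \<in> space S" and f: "f \<in> borel_measurable S" for x f
  proof -
    have [measurable]: "f \<in> borel_measurable (Q x)" "?E \<in> sets (Q x)" "{x0} \<in> sets (Q x)"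
      using x f E x0 by (auto simp: borel_measurable_Q sets_Q)
    have "(\<integral>\<^sup>+ y. f y \<partial>Q x) = (\<integral>\<^sup>+ y. f y * indicator ?E y + f x0 * indicator {x0} y \<partial>Q x)"
      by (intro nn_integral_cong) (auto simp: space_Q x indicator_def)
    also have "\<dots> = (\<integral>\<^sup>+ y\<in>?E. f y \<partial>Q x) + f x0 * emeasure (Q x) {x0}"
      by (subst nn_integral_add) (auto simp: nn_integral_cmult_indicator)
    finally show ?thesis by (simp add: nn_J[OF x f] r_def distrib_left ac_simps)
  qed
  \<comment> \<open>Recurrence: every step either continues the excursion or ends it. Comparison
    with the renewal identity for the constant 1 leaves return mass 1, once the finite continuing
    mass is cancelled.\<close>
  have return: "(\<integral>\<^sup>+ x. r x \<partial>\<nu>) = 1"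
  proof -
    have one: "(\<integral>\<^sup>+ y. 1 \<partial>J x) + r x = 1" if "x \<in> space S" for x
    proof -
      have "ennreal (1 / ?q x) * (\<integral>\<^sup>+ y. 1 \<partial>Q x) = 1"
        using that by (simp add: space_Q emeasure_space_Q inv_q)
      then show ?thesis using decomp[OF that, of "\<lambda>_. 1"] by (simp del: nn_integral_const)
    qed
    have "(\<integral>\<^sup>+ x. (\<integral>\<^sup>+ y. 1 \<partial>J x) \<partial>\<nu>) + (\<integral>\<^sup>+ x. r x \<partial>\<nu>) = (\<integral>\<^sup>+ x. (\<integral>\<^sup>+ y. 1 \<partial>J x) + r x \<partial>\<nu>)"
      using J_meas[of "\<lambda>_. 1"] by (intro nn_integral_add[symmetric]) (auto simp: bm_\<nu>)
    also have "\<dots> = (\<integral>\<^sup>+ x. 1 \<partial>\<nu>)" by (intro nn_integral_cong) (simp only: space_\<nu> one)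
    also have "\<dots> = (\<integral>\<^sup>+ x. (\<integral>\<^sup>+ y. 1 \<partial>J x) \<partial>\<nu>) + 1"
      using renewal[of "\<lambda>_. 1"] by (simp add: add.commute)
    finally have "(\<integral>\<^sup>+ x. (\<integral>\<^sup>+ y. 1 \<partial>J x) \<partial>\<nu>) + (\<integral>\<^sup>+ x. r x \<partial>\<nu>) = (\<integral>\<^sup>+ x. (\<integral>\<^sup>+ y. 1 \<partial>J x) \<partial>\<nu>) + 1" .
    moreover have "(\<integral>\<^sup>+ x. (\<integral>\<^sup>+ y. 1 \<partial>J x) \<partial>\<nu>) \<le> (\<integral>\<^sup>+ x. 1 \<partial>\<nu>)"
      by (subst (2) renewal) (rule measurable_const, simp, rule add_increasing, simp_all only: zero_le order_refl)
    then have "(\<integral>\<^sup>+ x. (\<integral>\<^sup>+ y. 1 \<partial>J x) \<partial>\<nu>) \<noteq> \<infinity>"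
      using \<nu>_finite by (auto simp: space_\<nu> top_unique)
    ultimately show ?thesis unfolding ennreal_add_left_cancel by blast
  qed
  \<comment> \<open>The mean holding time \<open>1 / ?q x\<close> as a weight turns numbers of
    visits into occupation time.\<close>
  define \<rho> where "\<rho> = density \<nu> (\<lambda>x. ennreal (1 / ?q x))"
  have sets_\<rho>: "sets \<rho> = sets S" by (simp add: \<rho>_def sets_\<nu>)
  have space_\<rho>: "space \<rho> = space S" using sets_\<rho> by (rule sets_eq_imp_space_eq)
  have nn_\<rho>: "(\<integral>\<^sup>+ x. f x \<partial>\<rho>) = (\<integral>\<^sup>+ x. ennreal (1 / ?q x) * f x \<partial>\<nu>)" if "f \<in> borel_measurable S" for f
    unfolding \<rho>_def using that by (intro nn_integral_density) (auto simp: bm_\<nu>)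
  have q_\<rho>: "(\<integral>\<^sup>+ x. ennreal (?q x) * f x \<partial>\<rho>) = (\<integral>\<^sup>+ x. f x \<partial>\<nu>)" if [measurable]: "f \<in> borel_measurable S" for f
  proof -
    have "(\<integral>\<^sup>+ x. ennreal (?q x) * f x \<partial>\<rho>) = (\<integral>\<^sup>+ x. ennreal (1 / ?q x) * (ennreal (?q x) * f x) \<partial>\<nu>)"
      by (rule nn_\<rho>) measurable
    also have "\<dots> = (\<integral>\<^sup>+ x. f x \<partial>\<nu>)"
      by (intro nn_integral_cong) (simp add: space_\<nu> mult.assoc[symmetric] inv_q)
    finally show ?thesis .
  qed
  have balance: "(\<integral>\<^sup>+ x. (\<integral>\<^sup>+ y. f y \<partial>Q x) \<partial>\<rho>) = (\<integral>\<^sup>+ x. ennreal (?q x) * f x \<partial>\<rho>)"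
    if f [measurable]: "f \<in> borel_measurable S" for f
  proof -
    have "(\<integral>\<^sup>+ x. (\<integral>\<^sup>+ y. f y \<partial>Q x) \<partial>\<rho>) = (\<integral>\<^sup>+ x. (\<integral>\<^sup>+ y. f y \<partial>J x) + r x * f x0 \<partial>\<nu>)"
      unfolding nn_\<rho>[OF measurable_nn_integral_Q[OF f]] by (intro nn_integral_cong decomp f) (simp add: space_\<nu>)
    also have "\<dots> = (\<integral>\<^sup>+ x. (\<integral>\<^sup>+ y. f y \<partial>J x) \<partial>\<nu>) + (\<integral>\<^sup>+ x. r x \<partial>\<nu>) * f x0"
      using J_meas[OF f] r by (subst nn_integral_add) (auto simp: bm_\<nu> nn_integral_multc)
    \<comment> \<open>Return mass 1 supplies exactly the term \<open>f x0\<close> of the renewal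
      identity, as if the next excursion started.\<close>
    also have "\<dots> = (\<integral>\<^sup>+ x. ennreal (?q x) * f x \<partial>\<rho>)"
      by (simp add: return renewal[OF f] q_\<rho>[OF f] add.commute)
    finally show ?thesis .
  qed
  let ?m = "emeasure \<rho> (space S)"
  have m_eq: "?m = (\<integral>\<^sup>+ x. ennreal (1 / ?q x) \<partial>\<nu>)"
    using nn_\<rho>[of "\<lambda>_. 1"] by (simp add: space_\<rho>)
  \<comment> \<open>The lower bound \<open>c\<close> on the rates bounds the holding times, so a
    finite number of visits gives a finite mean duration.\<close>
  have m_fin: "?m < \<infinity>"
  proof -
    have "?m \<le> (\<integral>\<^sup>+ x. ennreal (1 / c) \<partial>\<nu>)"
      unfolding m_eq using c by (intro nn_integral_mono ennreal_leI) (auto simp: space_\<nu> intro!: divide_left_mono mult_pos_pos q_pos)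
    also have "\<dots> < \<infinity>" using \<nu>_finite by (simp add: space_\<nu> ennreal_mult_less_top)
    finally show ?thesis .
  qed
  have m_pos: "?m \<noteq> 0"
  proof -
    have "ennreal (1 / ?q x0) \<le> ?m"
      unfolding m_eq by (subst renewal) auto
    then show ?thesis using q_pos[OF x0(1)] by auto
  qed
  let ?\<pi> = "scale_measure (1 / ?m) \<rho>"
  have nn_\<pi>: "(\<integral>\<^sup>+ x. f x \<partial>?\<pi>) = 1 / ?m * (\<integral>\<^sup>+ x. f x \<partial>\<rho>)" if "f \<in> borel_measurable S" for f
    using that by (intro nn_integral_scale_measure) (simp add: measurable_cong_sets[OF sets_\<rho> refl])
  have "stationary_distribution S Q ?\<pi>"
  proof (rule stationary_distributionI)
    show "prob_space ?\<pi>"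
      using m_fin m_pos by (intro prob_spaceI) (simp add: space_scale_measure space_\<rho> ennreal_divide_times)
    show "sets ?\<pi> = sets S" by (simp add: sets_\<rho>)
    have "(\<integral>\<^sup>+ x. ennreal (?q x) \<partial>\<rho>) = emeasure \<nu> (space S)"
      using q_\<rho>[of "\<lambda>_. 1"] by (simp add: space_\<nu>)
    then show "(\<integral>\<^sup>+ x. ennreal (?q x) \<partial>?\<pi>) < \<infinity>"
      using \<nu>_finite m_pos by (simp add: nn_\<pi> ennreal_divide_times ennreal_divide_eq_top_iff less_top[symmetric])
    show "(\<integral>\<^sup>+ x. (\<integral>\<^sup>+ y. f y \<partial>Q x) \<partial>?\<pi>) = (\<integral>\<^sup>+ x. ennreal (?q x) * f x \<partial>?\<pi>)"
      if [measurable]: "f \<in> borel_measurable S" for f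
      by (simp add: nn_\<pi> measurable_nn_integral_Q balance)
  qed
  then show ?thesis by blast
qed

end

section \<open>Measurability on spaces of lists\<close>

lemma measurable_list_spaceI:
  assumes "f \<in> space N \<rightarrow> lists (space M)"
    and "\<And>As. As \<in> lists (sets M) \<Longrightarrow> f -` listset As \<inter> space N \<in> sets N"
  shows "f \<in> measurable N (list_space M)"
  unfolding list_space_def
proof (rule measurable_measure_of)
  show "{listset As | As. As \<in> lists (sets M)} \<subseteq> Pow (lists (space M))"
    using sets.space_closed[of "list_space M"] unfolding space_list_space sets_list_space
    by (meson sigma_sets.Basic subset_eq)
qed (use assms in auto)

lemma listset_sets: "As \<in> lists (sets M) \<Longrightarrow> listset As \<in> sets (list_space M)"
  unfolding sets_list_space by (intro sigma_sets.Basic) auto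

lemma listset_subset_lists: "As \<in> lists (sets M) \<Longrightarrow> listset As \<subseteq> lists (space M)"
  using sets.sets_into_space[OF listset_sets] by (simp add: space_list_space)

lemma Nil_in_listset [simp]: "[] \<in> listset As \<longleftrightarrow> As = []"
  by (cases As) (auto simp: set_Cons_def)

lemma Cons_in_listset: "x # xs \<in> listset As \<longleftrightarrow> (\<exists>A Bs. As = A # Bs \<and> x \<in> A \<and> xs \<in> listset Bs)"
  by (cases As) (auto simp: set_Cons_def)

lemma append1_in_listset: "xs @ [x] \<in> listset As \<longleftrightarrow> (\<exists>Bs A. As = Bs @ [A] \<and> xs \<in> listset Bs \<and> x \<in> A)"
proof (induction xs arbitrary: As)
  case Nil
  show ?case
  proof (cases As)
    case (Cons A Bs)
    then show ?thesis by (cases Bs) (auto simp: set_Cons_def append_eq_Cons_conv)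
  qed simp
next
  case (Cons y ys)
  show ?case by (auto simp: Cons_in_listset Cons.IH Cons_eq_append_conv; force simp: Cons_in_listset)
qed

lemma listset_replicate: "listset (replicate n A) = {xs \<in> lists A. length xs = n}"
  by (induction n) (auto simp: set_Cons_def length_Suc_conv)

lemma replicate_in_lists: "a \<in> A \<Longrightarrow> replicate n a \<in> lists A"
  by (induction n) auto

lemma measurable_length [measurable]: "length \<in> measurable (list_space M) (count_space UNIV)"
proof -
  have "length -` {n} \<inter> space (list_space M) \<in> sets (list_space M)" for n :: nat
    using listset_sets[OF replicate_in_lists[OF sets.top], of n M]
    by (simp add: listset_replicate space_list_space Int_def vimage_def conj_commute)
  then show ?thesis by (auto simp: measurable_count_space_eq2_countable)
qed

lemma measurable_Cons [measurable (raw)]: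
  assumes f: "f \<in> measurable N M" and g: "g \<in> measurable N (list_space M)"
  shows "(\<lambda>x. f x # g x) \<in> measurable N (list_space M)"
proof (rule measurable_list_spaceI)
  show "(\<lambda>x. f x # g x) \<in> space N \<rightarrow> lists (space M)"
    using measurable_space[OF f] measurable_space[OF g] by (auto simp: space_list_space)
  fix As assume As: "As \<in> lists (sets M)"
  show "(\<lambda>x. f x # g x) -` listset As \<inter> space N \<in> sets N"
  proof (cases As)
    case (Cons A Bs)
    then have "(\<lambda>x. f x # g x) -` listset As \<inter> space N = (f -` A \<inter> space N) \<inter> (g -` listset Bs \<inter> space N)"
      by (auto simp: Cons_in_listset simp del: listset.simps)
    then show ?thesis using As Cons f g listset_sets[of Bs M] by (auto intro!: measurable_sets)
  next
    case Nil
    then have "(\<lambda>x. f x # g x) -` listset As \<inter> space N = {}" by auto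
    then show ?thesis by simp
  qed
qed

lemma measurable_append1 [measurable (raw)]:
  assumes f: "f \<in> measurable N (list_space M)" and g: "g \<in> measurable N M"
  shows "(\<lambda>x. f x @ [g x]) \<in> measurable N (list_space M)"
proof (rule measurable_list_spaceI)
  show "(\<lambda>x. f x @ [g x]) \<in> space N \<rightarrow> lists (space M)"
    using measurable_space[OF f] measurable_space[OF g] by (auto simp: space_list_space)
  fix As assume As: "As \<in> lists (sets M)"
  show "(\<lambda>x. f x @ [g x]) -` listset As \<inter> space N \<in> sets N"
  proof (cases As rule: rev_cases)
    case (snoc Bs A)
    then have "(\<lambda>x. f x @ [g x]) -` listset As \<inter> space N = (f -` listset Bs \<inter> space N) \<inter> (g -` A \<inter> space N)"
      by (auto simp: append1_in_listset)
    then show ?thesis using As snoc f g listset_sets[of Bs M] by (auto intro!: measurable_sets)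
  next
    case Nil
    then have "(\<lambda>x. f x @ [g x]) -` listset As \<inter> space N = {}" by auto
    then show ?thesis by simp
  qed
qed

lemma measurable_tl [measurable]: "tl \<in> measurable (list_space M) (list_space M)"
proof (rule measurable_list_spaceI)
  fix As assume As: "As \<in> lists (sets M)"
  \<comment> \<open>Since \<open>tl [] = []\<close>, the preimage of the box of length 0 contains
    the empty list besides the lists of length 1.\<close>
  have "tl -` listset As \<inter> space (list_space M) = listset (space M # As) \<union> (if As = [] then listset [] else {})"
  proof (intro set_eqI)
    fix xs show "xs \<in> tl -` listset As \<inter> space (list_space M) \<longleftrightarrow>
        xs \<in> listset (space M # As) \<union> (if As = [] then listset [] else {})"
      using listset_subset_lists[OF As] by (cases xs) (auto simp: space_list_space set_Cons_def)
  qed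
  moreover have "listset (space M # As) \<in> sets (list_space M)" "listset [] \<in> sets (list_space M)"
    using As listset_sets[of "space M # As" M] listset_sets[of "[]" M] by (simp_all del: listset.simps)
  ultimately show "tl -` listset As \<inter> space (list_space M) \<in> sets (list_space M)"
    by (auto simp del: listset.simps)
next
  show "tl \<in> space (list_space M) \<rightarrow> lists (space M)"
  proof
    fix xs assume "xs \<in> space (list_space M)"
    then show "tl xs \<in> lists (space M)" by (cases xs) (auto simp: space_list_space)
  qed
qed

text \<open>\<open>hd []\<close> is unspecified, so the empty list is sent to a fixed point
  \<open>d\<close> of the space. Preimages split into boxes, one for each length.\<close>

lemma measurable_hd_default:
  assumes d: "d \<in> space M"
  shows "(\<lambda>xs. if xs = [] then d else hd xs) \<in> measurable (list_space M) M"
proof (rule measurableI)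
  fix A assume A: "A \<in> sets M"
  let ?f = "\<lambda>xs. if xs = [] then d else hd xs"
  have "?f -` A \<inter> space (list_space M)
      = (\<Union>n. listset (A # replicate n (space M))) \<union> (if d \<in> A then listset [] else {})" (is "?L = ?R")
  proof (intro set_eqI)
    fix xs show "xs \<in> ?L \<longleftrightarrow> xs \<in> ?R"
      using sets.sets_into_space[OF A]
      by (cases xs) (auto simp: space_list_space set_Cons_def listset_replicate)
  qed
  moreover have "listset (A # replicate n (space M)) \<in> sets (list_space M)" "listset [] \<in> sets (list_space M)" for n
    using A replicate_in_lists[OF sets.top, of n M] listset_sets[of "A # replicate n (space M)" M] listset_sets[of "[]" M]
    by (simp_all del: listset.simps)
  ultimately show "?f -` A \<inter> space (list_space M) \<in> sets (list_space M)"
    by (auto simp del: listset.simps)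
qed (use d in \<open>auto simp: space_list_space lists_eq_set\<close>)

lemma measurable_drop [measurable]: "drop n \<in> measurable (list_space M) (list_space M)"
proof (induction n)
  case (Suc n)
  have "(\<lambda>xs. drop n (tl xs)) \<in> measurable (list_space M) (list_space M)"
    by (rule measurable_compose[OF measurable_tl Suc])
  then show ?case by (simp add: drop_Suc[abs_def])
qed (simp add: drop_0[abs_def])

lemma measurable_nth_default:
  assumes "d \<in> space M"
  shows "(\<lambda>xs. if i < length xs then xs ! i else d) \<in> measurable (list_space M) M"
proof -
  have "(if i < length xs then xs ! i else d) = (if drop i xs = [] then d else hd (drop i xs))" for xs
    by (simp add: hd_drop_conv_nth)
  then show ?thesis using measurable_compose[OF measurable_drop measurable_hd_default[OF assms]] by simp
qed

lemma measurable_remove_nth [measurable]: "remove_nth i \<in> measurable (list_space M) (list_space M)"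
proof (cases "space M = {}")
  \<comment> \<open>Over an empty space the empty list is the only state, and no default for
    \<open>hd\<close> exists.\<close>
  case True
  have "remove_nth i xs = xs" if "xs \<in> space (list_space M)" for xs
    using that True by (auto simp: space_list_space remove_nth_def)
  then show ?thesis using measurable_cong[of "list_space M" "remove_nth i" "\<lambda>x. x"] by auto
next
  case False
  then obtain d where d: "d \<in> space M" by auto
  note [measurable] = measurable_hd_default[OF d]
  show ?thesis
  proof (induction i)
    case 0
    have "remove_nth 0 xs = tl xs" for xs :: "'a list" by (simp add: remove_nth_def drop_Suc)
    then have "remove_nth 0 = (tl :: 'a list \<Rightarrow> _)" by auto
    then show ?case by simp
  next
    case (Suc i)
    \<comment> \<open>A recursion through \<open>hd\<close> and \<open>tl\<close>; the outer test
      catches the empty list, so the value \<open>d\<close> is never taken.\<close>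
    have *: "remove_nth (Suc i) xs = (if length xs = 0 then xs else (if xs = [] then d else hd xs) # remove_nth i (tl xs))" for xs
      by (cases xs) (auto simp: remove_nth_def)
    have [measurable]: "(\<lambda>xs. remove_nth i (tl xs)) \<in> measurable (list_space M) (list_space M)"
      by (rule measurable_compose[OF measurable_tl Suc])
    show ?case unfolding *[abs_def] by measurable
  qed
qed

section \<open>The FIFM process\<close>

text \<open>The increments are \<open>3 + c * \<beta> ^ k\<close>: for large \<open>k\<close> departures dominate and slope \<open>3\<close> suffices, for
  small \<open>k\<close> the geometric part makes up for the arrivals.\<close>
lemma queue_lyapunov_exists:
  fixes mu L :: real
  assumes mu: "0 < mu" and L: "0 < L"
  obtains v :: "nat \<Rightarrow> real" where "v 0 = 0" "\<And>n. 0 \<le> v n"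
    "\<And>n a b. 0 \<le> a \<Longrightarrow> 0 \<le> b \<Longrightarrow> a + b = L \<Longrightarrow>
       (real (Suc n) * mu + a) * v n + b * v (Suc (Suc n)) + (real (Suc n) * mu + L)
         \<le> (real (Suc n) * mu + L) * v (Suc n)"
proof -
  \<comment> \<open>With this ratio \<open>L * \<beta> \<le> mu / 2\<close>: the geometric part of
    the next increment, weighted with all arrivals, uses up at most half of the gain from a single
    departure rate \<open>mu\<close>.\<close>
  define \<beta> where "\<beta> = mu / (mu + 2 * L)"
  have \<beta>: "0 < \<beta>" "\<beta> \<le> 1" "L * \<beta> \<le> mu / 2"
    using mu L by (auto simp: \<beta>_def field_simps)
  \<comment> \<open>From \<open>N\<close> particles on, departures have rate at least
    \<open>2 * L\<close>. Below that level, \<open>c\<close> is so large that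
    \<open>c * \<beta> ^ n * (mu / 2)\<close> alone reaches \<open>4 * L\<close>.\<close>
  obtain N :: nat where N: "2 * L / mu \<le> real N" using real_arch_simple by blast
  define c where "c = 8 * L / (mu * \<beta> ^ N)"
  have c: "0 < c" using mu L \<beta> by (simp add: c_def)
  define d where "d k = 3 + c * \<beta> ^ k" for k
  define v where "v n = (\<Sum>k<n. d k)" for n
  have d_pos: "0 \<le> d k" for k using c \<beta> by (simp add: d_def)
  \<comment> \<open>The worst case, in which every arrival joins. The one unit due per jump turns
    the slope 3 into 4 in front of \<open>L\<close> and into 2 in front of the departure rate; what
    remains to show is that \<open>4 * L\<close> is at most \<open>2 * ?m * mu\<close> plus the
    geometric gain.\<close>
  have key: "L * d (Suc n) + real (Suc n) * mu + L \<le> real (Suc n) * mu * d n" for n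
  proof -
    let ?m = "real (Suc n)"
    have m: "mu / 2 \<le> ?m * mu - L * \<beta>" 
    proof -
      have "mu \<le> ?m * mu" using mu by simp
      with \<beta>(3) show ?thesis by linarith
    qed
    have cb: "0 \<le> c * \<beta> ^ n" using c \<beta> by simp
    have lower: "c * \<beta> ^ n * (mu / 2) \<le> c * \<beta> ^ n * (?m * mu - L * \<beta>)" by (rule mult_left_mono[OF m cb])
    have "4 * L \<le> 2 * ?m * mu + c * \<beta> ^ n * (mu / 2)"
    proof (cases "N \<le> n")
      case True
      then have "2 * L / mu \<le> ?m" using N by simp
      then have "2 * L \<le> ?m * mu" using mu by (simp add: field_simps)
      moreover have "0 \<le> c * \<beta> ^ n * (mu / 2)" using cb mu by simp
      ultimately show ?thesis by linarith
    next
      case False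
      then have "\<beta> ^ N \<le> \<beta> ^ n" using \<beta> by (intro power_decreasing) auto
      then have "c * \<beta> ^ N * (mu / 2) \<le> c * \<beta> ^ n * (mu / 2)"
        using c mu by (intro mult_right_mono mult_left_mono) auto
      moreover have "c * \<beta> ^ N * (mu / 2) = 4 * L" using mu \<beta> by (simp add: c_def)
      moreover have "0 \<le> 2 * ?m * mu" using mu by simp
      ultimately show ?thesis by linarith
    qed
    with lower have "4 * L \<le> 2 * ?m * mu + c * \<beta> ^ n * (?m * mu - L * \<beta>)" by linarith
    then show ?thesis by (simp add: d_def algebra_simps)
  qed
  show thesis
  proof
    show "v 0 = 0" by (simp add: v_def)
    show "0 \<le> v n" for n by (simp add: v_def sum_nonneg d_pos)
    \<comment> \<open>\<open>a\<close> stands for the rate of matched arrivals, \<open>b\<close> for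
      the rate of those that join.\<close>
    fix n and a b :: real assume ab: "0 \<le> a" "0 \<le> b" "a + b = L"
    have "b * d (Suc n) \<le> L * d (Suc n)" "0 \<le> a * d n"
      using ab d_pos by (auto intro: mult_right_mono)
    with key[of n] have "b * d (Suc n) + real (Suc n) * mu + L \<le> (real (Suc n) * mu + a) * d n"
      by (simp add: distrib_right)
    moreover have "v (Suc n) = v n + d n" "v (Suc (Suc n)) = v n + d n + d (Suc n)" by (simp_all add: v_def)
    moreover have "(real (Suc n) * mu + L) * (v n + d n) - (real (Suc n) * mu + a) * v n - b * (v n + d n + d (Suc n))
        = (real (Suc n) * mu + a) * d n - b * d (Suc n)"
      using ab(3) by (simp add: algebra_simps flip: ab(3))
    ultimately show "(real (Suc n) * mu + a) * v n + b * v (Suc (Suc n)) + (real (Suc n) * mu + L)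
         \<le> (real (Suc n) * mu + L) * v (Suc n)"
      by simp
  qed
qed

text \<open>The type class is only \<open>metric_space\<close>, so separability is drawn from
  compactness: the union of finite nets of all radii \<open>1 / Suc n\<close>.\<close>

lemma compact_space_countable_dense:
  assumes "compact (UNIV :: 'a set)"
  obtains C :: "'a::metric_space set" where "countable C" "\<And>x e. 0 < e \<Longrightarrow> \<exists>c\<in>C. dist x c < e"
proof -
  have "\<forall>n::nat. \<exists>K. finite K \<and> UNIV \<subseteq> (\<Union>x\<in>K. ball (x::'a) (1 / real (Suc n)))"
    using assms by (simp add: compact_eq_totally_bounded)
  from choice[OF this] obtain K :: "nat \<Rightarrow> 'a set"
    where K: "\<And>n. finite (K n)" "\<And>n. UNIV \<subseteq> (\<Union>x\<in>K n. ball x (1 / real (Suc n)))" by blast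
  show thesis
  proof
    show "countable (\<Union>n. K n)" using K(1) by (auto intro: countable_finite)
    fix x :: 'a and e :: real assume "0 < e"
    then obtain n where n: "1 / real (Suc n) < e" using reals_Archimedean by (auto simp: inverse_eq_divide)
    obtain c where "c \<in> K n" "dist c x < 1 / real (Suc n)" using K(2)[of n] by fastforce
    with n show "\<exists>c\<in>\<Union>n. K n. dist x c < e" by (force simp: dist_commute)
  qed
qed

section \<open>The neighbourhood relation\<close>

abbreviation particle_space :: "'a::metric_space particle measure" where
  "particle_space \<equiv> borel \<Otimes>\<^sub>M count_space UNIV"

lemma finite_UNIV_colour: "finite (UNIV :: colour set)"
proof -
  have "UNIV = {Red, Blue}" using colour.exhaust by auto
  then show ?thesis by (metis finite.emptyI finite.insertI)
qed

text \<open>An open relation need not lie in a product of Borel algebras, so it is written as a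
  countable union of rectangles: a centre \<open>c\<close> from a countable dense set, and a
  rational split of the distance 1 into \<open>r\<close> and \<open>1 - r\<close>.\<close>

lemma nbhd_relation_sets:
  assumes "compact (UNIV :: 'a::metric_space set)"
  shows "{p. snd p \<in> nbhd (fst p)} \<in> sets (particle_space \<Otimes>\<^sub>M (particle_space :: 'a particle measure))"
proof -
  let ?B = "particle_space :: 'a particle measure"
  obtain C :: "'a set" where C: "countable C" "\<And>x e. 0 < e \<Longrightarrow> \<exists>c\<in>C. dist x c < e"
    using compact_space_countable_dense[OF assms] by blast
  have rect: "(ball c r \<times> {a}) \<times> (ball c s \<times> {b}) \<in> sets (?B \<Otimes>\<^sub>M ?B)" for c :: 'a and r s a b
    by (intro pair_measureI) auto
  have "{p. snd p \<in> nbhd (fst p)} =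
      (\<Union>a\<in>UNIV. \<Union>c\<in>C. \<Union>r\<in>\<rat>. (ball c r \<times> {a}) \<times> (ball c (1 - r) \<times> {opp a}))" (is "?L = ?R")
  proof
    show "?R \<subseteq> ?L"
    proof clarsimp
      fix a c r x y assume "dist c x < r" "dist c y < 1 - r"
      then have "dist x y < 1" using dist_triangle_less_add[of x c r y "1 - r"] by (simp add: dist_commute)
      then show "(y, opp a) \<in> nbhd (x, a)" by (simp add: nbhd_def)
    qed
    show "?L \<subseteq> ?R"
    proof
      fix p assume "p \<in> ?L"
      then obtain x a y where p: "p = ((x, a), (y, opp a))" and xy: "dist x y < 1"
        by (cases p) (auto simp: nbhd_def)
      \<comment> \<open>The detour through \<open>c\<close> exceeds \<open>dist x y\<close> by at
        most \<open>2 * dist x c\<close>, so half of the slack suffices.\<close>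
      obtain c where c: "c \<in> C" "dist x c < (1 - dist x y) / 2" using C(2)[of "(1 - dist x y) / 2" x] xy by auto
      have "dist c y \<le> dist x c + dist x y" using dist_triangle[of c y x] by (simp add: dist_commute)
      with c(2) have "dist x c < 1 - dist c y" by (simp add: field_simps)
      then obtain r where "r \<in> \<rat>" "dist x c < r" "r < 1 - dist c y" using Rats_dense_in_real by blast
      then have "(x, a) \<in> ball c r \<times> {a}" "(y, opp a) \<in> ball c (1 - r) \<times> {opp a}"
        by (auto simp: dist_commute)
      with c(1) \<open>r \<in> \<rat>\<close> show "p \<in> ?R" unfolding p by blast
    qed
  qed
  also have "\<dots> \<in> sets (?B \<Otimes>\<^sub>M ?B)"
    by (rule sets.finite_UN[OF finite_UNIV_colour]) (intro sets.countable_UN'' C(1) countable_rat rect)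
  finally show ?thesis .
qed

lemma mem_nbhds: "z \<in> nbhds (set xs) \<longleftrightarrow> (\<exists>j<length xs. z \<in> nbhd (xs ! j))"
  unfolding nbhds_def UN_iff by (metis in_set_conv_nth)

lemma mem_nbhds_take: "z \<in> nbhds (set (take i xs)) \<longleftrightarrow> (\<exists>j<i. j < length xs \<and> z \<in> nbhd (xs ! j))"
  by (auto simp: mem_nbhds)

section \<open>The matching process as a measurable rate kernel\<close>

locale fifm =
  fixes lam :: "'a::metric_space measure" and mu :: real
  assumes compact: "compact (UNIV :: 'a set)" and radon: "radon_measure lam" and mu: "mu > 0"
begin

abbreviation "lam2 \<equiv> particle_measure lam"
abbreviation "states \<equiv> fifm_space :: 'a particle list measure"
abbreviation "rates \<equiv> fifm_rates lam mu"

lemma sets_lam: "sets lam = sets borel"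
  using radon by (simp add: radon_measure_def)

lemma space_lam: "space lam = UNIV"
  using sets_eq_imp_space_eq[OF sets_lam] by simp

lemma sets_lam2 [measurable_cong]: "sets lam2 = sets particle_space"
  unfolding particle_measure_def by (rule sets_pair_measure_cong) (simp_all add: sets_lam)

lemma space_particle_space: "space (particle_space :: 'a particle measure) = UNIV"
  by (simp add: space_pair_measure)

text \<open>Compactness extracts a finite cover from the open sets of finite measure that local
  finiteness provides.\<close>

lemma finite_lam: "finite_measure lam"
proof (rule finite_measureI)
  have "\<exists>U. \<forall>x. open (U x) \<and> x \<in> U x \<and> emeasure lam (U x) < \<infinity>"
    using radon unfolding radon_measure_def by (intro choice) blast
  then obtain U where U: "\<And>x. open (U x)" "\<And>x. x \<in> U x" "\<And>x. emeasure lam (U x) < \<infinity>" by blast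
  obtain K where K: "finite K" "UNIV \<subseteq> (\<Union>x\<in>K. U x)"
    using compactE_image[OF compact, of UNIV U] U by (metis UNIV_I UN_iff subsetI)
  have "emeasure lam UNIV \<le> emeasure lam (\<Union>x\<in>K. U x)"
    using K(2) U(1) by (intro emeasure_mono) (auto simp: sets_lam intro!: borel_open open_UN)
  also have "\<dots> \<le> (\<Sum>x\<in>K. emeasure lam (U x))"
    using K(1) U(1) by (intro emeasure_subadditive_finite) (auto simp: sets_lam)
  also have "\<dots> < \<infinity>" using K(1) U(3) by simp
  finally show "emeasure lam (space lam) \<noteq> \<infinity>" by (simp add: space_lam)
qed

sublocale lam2: finite_measure lam2
  unfolding particle_measure_def
  by (intro finite_measure_pair_measure finite_lam finite_measure_count_space finite_UNIV_colour)

lemma space_states: "space states = UNIV"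
  by (simp add: fifm_space_def space_list_space space_particle_space)

lemma nbhds_set_sets: "nbhds (set \<eta>) \<in> sets (particle_space :: 'a particle measure)"
  unfolding nbhds_def by (intro sets.finite_UN) (auto simp: nbhd_sets)

lemma sets_rates: "sets (rates \<eta>) = sets states"
  by (simp add: fifm_rates_def sets.sigma_sets_eq sets.space_closed)

lemma space_rates: "space (rates \<eta>) = UNIV"
  using sets_eq_imp_space_eq[OF sets_rates] by (simp add: space_states)

text \<open>Beyond the length \<open>xs ! i\<close> is unspecified, so a total version with an
  arbitrary default \<open>d\<close> is used; the length guard hides the default.\<close>

lemma measurable_nbhd_nth [measurable]:
  "Measurable.pred (states \<Otimes>\<^sub>M particle_space) (\<lambda>p. i < length (fst p) \<and> snd p \<in> nbhd (fst p ! i))"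
proof -
  fix d :: "'a particle"
  let ?f = "\<lambda>xs. if i < length xs then xs ! i else d"
  have f: "?f \<in> measurable states particle_space"
    unfolding fifm_space_def by (rule measurable_nth_default) (simp add: space_particle_space)
  have rel: "Measurable.pred (particle_space \<Otimes>\<^sub>M particle_space) (\<lambda>q :: 'a particle \<times> 'a particle. snd q \<in> nbhd (fst q))"
    using nbhd_relation_sets[OF compact] by (simp add: pred_def space_pair_measure)
  have len: "length \<in> measurable states (count_space UNIV)" unfolding fifm_space_def by measurable
  have "(\<lambda>p. (?f (fst p), snd p)) \<in> measurable (states \<Otimes>\<^sub>M particle_space) (particle_space \<Otimes>\<^sub>M particle_space)"
    using f by measurable
  from measurable_compose[OF this rel]
  have "Measurable.pred (states \<Otimes>\<^sub>M particle_space) (\<lambda>p. snd p \<in> nbhd (?f (fst p)))" by simp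
  then have "Measurable.pred (states \<Otimes>\<^sub>M particle_space) (\<lambda>p. i < length (fst p) \<and> snd p \<in> nbhd (?f (fst p)))"
    using len by measurable
  then show ?thesis by (rule measurable_cong[THEN iffD1, rotated]) auto
qed

lemma measurable_emeasure_section:
  assumes "Measurable.pred (states \<Otimes>\<^sub>M particle_space) (\<lambda>p. P (fst p) (snd p))"
  shows "(\<lambda>\<eta>. emeasure lam2 {z. P \<eta> z}) \<in> borel_measurable states"
proof -
  have sets_eq: "sets (states \<Otimes>\<^sub>M lam2) = sets (states \<Otimes>\<^sub>M particle_space)"
    by (rule sets_pair_measure_cong[OF refl sets_lam2])
  have "{p. P (fst p) (snd p)} \<in> sets (states \<Otimes>\<^sub>M lam2)"
    using assms unfolding sets_eq by (simp add: pred_def space_pair_measure space_states)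
  from lam2.measurable_emeasure_Pair[OF this] show ?thesis by (simp add: vimage_def)
qed

lemma measurable_emeasure_rates:
  assumes A: "A \<in> sets states"
  shows "(\<lambda>\<eta>. emeasure (rates \<eta>) A) \<in> borel_measurable states"
proof -
  \<comment> \<open>\<open>exclusive_nbhd\<close> expressed through guarded positions, which makes
    it a measurable condition on the pair of list and point.\<close>
  define W where "W i \<eta> z \<longleftrightarrow> (i < length \<eta> \<and> z \<in> nbhd (\<eta> ! i)) \<and> \<not> (\<exists>j<i. j < length \<eta> \<and> z \<in> nbhd (\<eta> ! j))"
    for i and \<eta> :: "'a particle list" and z
  define G where "G i \<eta> = (if i < length \<eta> then (ennreal mu + emeasure lam2 {z. W i \<eta> z}) * indicator A (remove_nth i \<eta>) else 0)"
    for i \<eta>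
  define H where "H \<eta> = emeasure lam2 {z. \<not> (\<exists>j. j < length \<eta> \<and> z \<in> nbhd (\<eta> ! j)) \<and> \<eta> @ [z] \<in> A}" for \<eta>
  have len [measurable]: "length \<in> measurable states (count_space UNIV)" unfolding fifm_space_def by measurable
  have [measurable]: "remove_nth i \<in> measurable states states" for i unfolding fifm_space_def by measurable
  have app: "(\<lambda>p. fst p @ [snd p]) \<in> measurable (states \<Otimes>\<^sub>M particle_space) states"
    unfolding fifm_space_def by measurable
  have W: "(\<lambda>\<eta>. emeasure lam2 {z. W i \<eta> z}) \<in> borel_measurable states" for i
    unfolding W_def by (rule measurable_emeasure_section) measurable
  have G: "G i \<in> borel_measurable states" for i
    unfolding G_def using W A by measurable
  have H: "H \<in> borel_measurable states"
    unfolding H_def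
  proof (rule measurable_emeasure_section)
    have [measurable]: "Measurable.pred (states \<Otimes>\<^sub>M particle_space) (\<lambda>p. fst p @ [snd p] \<in> A)"
      using measurable_sets[OF app A] by (simp add: pred_def vimage_def Int_def conj_commute)
    show "Measurable.pred (states \<Otimes>\<^sub>M particle_space)
        (\<lambda>p. \<not> (\<exists>j. j < length (fst p) \<and> snd p \<in> nbhd (fst p ! j)) \<and> fst p @ [snd p] \<in> A)"
      by measurable
  qed
  \<comment> \<open>The number of summands varies with the list, but is constant on each of the
    countably many sets of lists of equal length.\<close>
  have "(\<lambda>\<eta>. (\<Sum>i<length \<eta>. G i \<eta>) + H \<eta>) \<in> borel_measurable states"
  proof (rule measurable_compose_countable[OF _ len])
    show "(\<lambda>\<eta>. (\<Sum>i<n. G i \<eta>) + H \<eta>) \<in> borel_measurable states" for n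
      using G H by measurable
  qed
  moreover have "emeasure (rates \<eta>) A = (\<Sum>i<length \<eta>. G i \<eta>) + H \<eta>" for \<eta>
  proof -
    have "{z. W i \<eta> z} = exclusive_nbhd \<eta> i" if "i < length \<eta>" for i
      using that by (auto simp: W_def exclusive_nbhd_def mem_nbhds_take)
    then have "(\<Sum>i<length \<eta>. G i \<eta>) = (\<Sum>i<length \<eta>. (ennreal mu + emeasure lam2 (exclusive_nbhd \<eta> i)) * indicator A (remove_nth i \<eta>))"
      by (intro sum.cong) (auto simp: G_def)
    moreover have "H \<eta> = emeasure lam2 {z. z \<notin> nbhds (set \<eta>) \<and> \<eta> @ [z] \<in> A}"
      unfolding H_def by (intro arg_cong[where f="emeasure lam2"]) (auto simp: mem_nbhds)
    ultimately show ?thesis by (simp add: emeasure_fifm_rates[OF sets_lam A])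
  qed
  ultimately show ?thesis by simp
qed

section \<open>Total rates and jumps of the length\<close>

lemma exclusive_nbhd_sets: "exclusive_nbhd \<eta> i \<in> sets lam2"
  unfolding exclusive_nbhd_def sets_lam2 by (intro sets.Diff nbhd_sets nbhds_set_sets)

text \<open>Assigning each point to the earliest particle that it can be matched with partitions the
  joint neighbourhood, so the matching rates add up to its mass.\<close>

lemma sum_exclusive_nbhd:
  "(\<Sum>i<length \<eta>. emeasure lam2 (exclusive_nbhd \<eta> i)) = emeasure lam2 (nbhds (set \<eta>))"
proof -
  have "disjoint_family_on (exclusive_nbhd \<eta>) {..<length \<eta>}"
    unfolding disjoint_family_on_def
  proof (intro ballI impI)
    fix i j assume ij: "i \<in> {..<length \<eta>}" "j \<in> {..<length \<eta>}" "i \<noteq> j"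
    have "exclusive_nbhd \<eta> i \<inter> exclusive_nbhd \<eta> j = {}" if "i < j" "j < length \<eta>" for i j
      using that by (auto simp: exclusive_nbhd_def mem_nbhds_take)
    with ij show "exclusive_nbhd \<eta> i \<inter> exclusive_nbhd \<eta> j = {}"
      by (metis Int_commute lessThan_iff linorder_neqE_nat)
  qed
  then have "(\<Sum>i<length \<eta>. emeasure lam2 (exclusive_nbhd \<eta> i)) = emeasure lam2 (\<Union>i<length \<eta>. exclusive_nbhd \<eta> i)"
    by (intro sum_emeasure) (auto simp: exclusive_nbhd_sets)
  also have "(\<Union>i<length \<eta>. exclusive_nbhd \<eta> i) = nbhds (set \<eta>)"
  proof
    show "nbhds (set \<eta>) \<subseteq> (\<Union>i<length \<eta>. exclusive_nbhd \<eta> i)"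
    proof
      fix z assume "z \<in> nbhds (set \<eta>)"
      then obtain i where i: "i < length \<eta> \<and> z \<in> nbhd (\<eta> ! i)"
        by (auto simp: mem_nbhds)
      define k where "k = (LEAST i. i < length \<eta> \<and> z \<in> nbhd (\<eta> ! i))"
      have k: "k < length \<eta> \<and> z \<in> nbhd (\<eta> ! k)" unfolding k_def using i by (rule LeastI)
      have "z \<notin> nbhd (\<eta> ! j)" if "j < k" for j
        using not_less_Least[of j "\<lambda>i. i < length \<eta> \<and> z \<in> nbhd (\<eta> ! i)"] that k by (auto simp: k_def)
      with k have "z \<in> exclusive_nbhd \<eta> k"
        by (auto simp: exclusive_nbhd_def mem_nbhds_take)
      with k show "z \<in> (\<Union>i<length \<eta>. exclusive_nbhd \<eta> i)" by blast
    qed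
  qed (auto simp: exclusive_nbhd_def nbhds_def)
  finally show ?thesis .
qed

definition "total_arrival = measure lam2 UNIV"

lemma total_arrival_nonneg: "0 \<le> total_arrival"
  by (simp add: total_arrival_def)

lemma emeasure_nbhds_add_compl:
  "emeasure lam2 (nbhds (set \<eta>)) + emeasure lam2 (- nbhds (set \<eta>)) = ennreal total_arrival"
proof -
  have "emeasure lam2 (nbhds (set \<eta>)) + emeasure lam2 (- nbhds (set \<eta>)) = emeasure lam2 (nbhds (set \<eta>) \<union> - nbhds (set \<eta>))"
    using nbhds_set_sets[of \<eta>] sets.compl_sets[OF nbhds_set_sets[of \<eta>]]
    by (intro plus_emeasure) (auto simp: sets_lam2 space_particle_space Compl_eq_Diff_UNIV)
  then show ?thesis by (simp add: total_arrival_def lam2.emeasure_eq_measure)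
qed

lemma departure_rate: "(\<Sum>i<length \<eta>. ennreal mu + emeasure lam2 (exclusive_nbhd \<eta> i))
    = ennreal (real (length \<eta>) * mu) + emeasure lam2 (nbhds (set \<eta>))"
  using mu by (simp add: sum.distrib sum_exclusive_nbhd ennreal_mult ennreal_of_nat_eq_real_of_nat)

lemma length_sets: "{\<eta>. P (length \<eta>)} \<in> sets states"
proof -
  have "Measurable.pred states (\<lambda>\<eta>. P (length \<eta>))" unfolding fifm_space_def by measurable
  then show ?thesis by (simp add: pred_def space_states)
qed

lemma length_remove_nth: "i < length xs \<Longrightarrow> Suc (length (remove_nth i xs)) = length xs"
  by (simp add: remove_nth_def)

text \<open>The configuration enters only through the split of the arrival rate into matched and
  joining arrivals. For the empty list \<open>length \<eta> - 1\<close> is truncated to 0, but the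
  factor in front of it is then 0.\<close>

lemma emeasure_rates_length:
  "emeasure (rates \<eta>) {\<zeta>. P (length \<zeta>)} =
     (ennreal (real (length \<eta>) * mu) + emeasure lam2 (nbhds (set \<eta>))) * of_bool (P (length \<eta> - 1))
     + emeasure lam2 (- nbhds (set \<eta>)) * of_bool (P (Suc (length \<eta>)))"
proof -
  have "(\<Sum>i<length \<eta>. (ennreal mu + emeasure lam2 (exclusive_nbhd \<eta> i)) * indicator {\<zeta>. P (length \<zeta>)} (remove_nth i \<eta>))
      = (\<Sum>i<length \<eta>. (ennreal mu + emeasure lam2 (exclusive_nbhd \<eta> i)) * of_bool (P (length \<eta> - 1)))"
  proof (intro sum.cong refl)
    fix i assume "i \<in> {..<length \<eta>}"
    then have "length (remove_nth i \<eta>) = length \<eta> - 1" using length_remove_nth[of i \<eta>] by simp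
    then show "(ennreal mu + emeasure lam2 (exclusive_nbhd \<eta> i)) * indicator {\<zeta>. P (length \<zeta>)} (remove_nth i \<eta>)
       = (ennreal mu + emeasure lam2 (exclusive_nbhd \<eta> i)) * of_bool (P (length \<eta> - 1))" by (simp add: indicator_def)
  qed
  moreover have "emeasure lam2 {x. x \<notin> nbhds (set \<eta>) \<and> \<eta> @ [x] \<in> {\<zeta>. P (length \<zeta>)}}
      = emeasure lam2 (- nbhds (set \<eta>)) * of_bool (P (Suc (length \<eta>)))"
    by (cases "P (Suc (length \<eta>))") (auto simp: Compl_eq)
  ultimately show ?thesis
    by (simp add: emeasure_fifm_rates[OF sets_lam length_sets] sum_distrib_right[symmetric] departure_rate)
qed

lemma emeasure_rates_UNIV: "emeasure (rates \<eta>) UNIV = ennreal (real (length \<eta>) * mu + total_arrival)"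
  using emeasure_rates_length[of \<eta> "\<lambda>_. True"] mu total_arrival_nonneg
  by (simp add: add.assoc emeasure_nbhds_add_compl)

sublocale rate_kernel states rates
proof
  show "sets (rates \<eta>) = sets states" for \<eta> by (rule sets_rates)
  show "emeasure (rates \<eta>) (space states) \<noteq> \<infinity>" for \<eta> by (simp add: space_states emeasure_rates_UNIV)
qed (rule measurable_emeasure_rates)

lemma total_rate_fifm: "total_rate rates \<eta> = real (length \<eta>) * mu + total_arrival"
  using mu total_arrival_nonneg
  by (simp add: total_rate_def space_rates measure_def emeasure_rates_UNIV del: ennreal_plus)

section \<open>Reaching the empty list\<close>

lemma Nil_sets: "{[]} \<in> sets states"
  using length_sets[of "\<lambda>n. n = 0"] by simp

text \<open>All particles may leave one after the other by their own departures, before anybody arrives.\<close>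
lemma jump_trans_upto_Nil_pos:
  assumes "0 < a" "a \<le> 1"
  shows "\<exists>c>0. \<forall>\<eta> t. length \<eta> = n \<longrightarrow> a \<le> t \<longrightarrow> t \<le> 1 \<longrightarrow> c \<le> jump_trans_upto rates (Suc n) t \<eta> {[]}"
  using assms
proof (induction n arbitrary: a)
  case 0
  have "ennreal (exp (- total_arrival)) \<le> jump_trans_upto rates (Suc 0) t [] {[]}" if "0 \<le> t" "t \<le> 1" for t
  proof -
    have "total_arrival * t \<le> total_arrival * 1"
      using that total_arrival_nonneg by (intro mult_left_mono) auto
    then show ?thesis by (simp add: total_rate_fifm ennreal_leI)
  qed
  with 0 show ?case by (intro exI[of _ "ennreal (exp (- total_arrival))"]) auto
next
  case (Suc n)
  \<comment> \<open>The first departure may use up half of the guaranteed time, hence the induction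
    runs over all \<open>a\<close>.\<close>
  obtain c where c: "0 < c" "\<And>\<eta> t. length \<eta> = n \<Longrightarrow> a / 2 \<le> t \<Longrightarrow> t \<le> 1 \<Longrightarrow> c \<le> jump_trans_upto rates (Suc n) t \<eta> {[]}"
    using Suc.IH[of "a / 2"] Suc.prems by auto
  let ?q = "real (Suc n) * mu + total_arrival"
  let ?c = "ennreal (a / 2 * exp (- ?q)) * (c * ennreal mu)"
  have "?c \<le> jump_trans_upto rates (Suc (Suc n)) t \<eta> {[]}"
    if \<eta>: "length \<eta> = Suc n" and t: "a \<le> t" "t \<le> 1" for \<eta> t
  proof -
    \<comment> \<open>The departure rate \<open>mu\<close> of a single particle is a sufficient
      lower bound for the jump to length \<open>n\<close>.\<close>
    have "ennreal mu \<le> ennreal (real (Suc n) * mu)" using mu by (intro ennreal_leI) simp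
    also have "\<dots> \<le> emeasure (rates \<eta>) {\<zeta>. length \<zeta> = n}"
      using emeasure_rates_length[of \<eta> "\<lambda>k. k = n"] \<eta> by simp
    finally have "?c \<le> ennreal (a / 2 * exp (- total_rate rates \<eta>)) * (c * emeasure (rates \<eta>) {\<zeta>. length \<zeta> = n})"
      unfolding total_rate_fifm \<eta> by (intro mult_left_mono) auto
    also have "\<dots> \<le> jump_trans_upto rates (Suc (Suc n)) t \<eta> {[]}"
      by (rule jump_trans_upto_lower_bound) (use Suc.prems t c(2) length_sets[of "\<lambda>k. k = n"] in
          \<open>simp_all add: space_states del: jump_trans_upto.simps\<close>)
    finally show ?thesis .
  qed
  moreover have "0 < ?c" using c(1) mu Suc.prems by (simp add: ennreal_zero_less_mult_iff)
  ultimately show ?case by blast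
qed

lemma jump_trans_Nil_pos: "0 < jump_trans rates 1 \<eta> {[]}"
proof -
  \<comment> \<open>The bound \<open>Suc (length \<eta>)\<close> is strict and so admits
    \<open>length \<eta>\<close> departures.\<close>
  have "0 < jump_trans_upto rates (Suc (length \<eta>)) 1 \<eta> {[]}"
    using jump_trans_upto_Nil_pos[of 1 "length \<eta>"] by (auto intro: less_le_trans)
  also have "jump_trans_upto rates (Suc (length \<eta>)) 1 \<eta> {[]} \<le> jump_trans rates 1 \<eta> {[]}"
    unfolding jump_trans_def by (rule SUP_upper) simp
  finally show ?thesis .
qed

text \<open>\<open>rates \<eta>\<close> is carried by the lists that are one shorter or one longer,
  so \<open>v (length \<zeta>)\<close> takes only two values almost everywhere.\<close>

lemma nn_integral_rates_length:
  fixes v :: "nat \<Rightarrow> ennreal"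
  shows "(\<integral>\<^sup>+ \<zeta>. v (length \<zeta>) \<partial>rates \<eta>) =
     (ennreal (real (length \<eta>) * mu) + emeasure lam2 (nbhds (set \<eta>))) * v (length \<eta> - 1)
     + emeasure lam2 (- nbhds (set \<eta>)) * v (Suc (length \<eta>))"
proof -
  let ?D = "{\<zeta> :: 'a particle list. length \<zeta> = length \<eta> - 1}" and ?U = "{\<zeta> :: 'a particle list. length \<zeta> = Suc (length \<eta>)}"
  have sets: "?D \<in> sets (rates \<eta>)" "?U \<in> sets (rates \<eta>)" using length_sets[of "\<lambda>k. k = length \<eta> - 1"] length_sets[of "\<lambda>k. k = Suc (length \<eta>)"]
    by (simp_all add: sets_rates)
  have null: "{\<zeta>. length \<zeta> \<noteq> length \<eta> - 1 \<and> length \<zeta> \<noteq> Suc (length \<eta>)} \<in> null_sets (rates \<eta>)"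
    using length_sets[of "\<lambda>k. k \<noteq> length \<eta> - 1 \<and> k \<noteq> Suc (length \<eta>)"]
      emeasure_rates_length[of \<eta> "\<lambda>k. k \<noteq> length \<eta> - 1 \<and> k \<noteq> Suc (length \<eta>)"]
    by (simp add: null_sets_def sets_rates)
  have ne: "length \<eta> - 1 \<noteq> Suc (length \<eta>)" by linarith
  have D: "emeasure (rates \<eta>) ?D = ennreal (real (length \<eta>) * mu) + emeasure lam2 (nbhds (set \<eta>))"
    unfolding emeasure_rates_length[of \<eta> "\<lambda>k. k = length \<eta> - 1"] using ne[symmetric] by simp
  have U: "emeasure (rates \<eta>) ?U = emeasure lam2 (- nbhds (set \<eta>))"
    unfolding emeasure_rates_length[of \<eta> "\<lambda>k. k = Suc (length \<eta>)"] using ne by simp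
  have "(\<integral>\<^sup>+ \<zeta>. v (length \<zeta>) \<partial>rates \<eta>)
      = (\<integral>\<^sup>+ \<zeta>. v (length \<eta> - 1) * indicator ?D \<zeta> + v (Suc (length \<eta>)) * indicator ?U \<zeta> \<partial>rates \<eta>)"
    by (intro nn_integral_cong_AE AE_mp[OF AE_not_in[OF null] AE_I2]) (auto simp: indicator_def)
  also have "\<dots> = v (length \<eta> - 1) * emeasure (rates \<eta>) ?D + v (Suc (length \<eta>)) * emeasure (rates \<eta>) ?U"
    using sets by (subst nn_integral_add) (auto simp: nn_integral_cmult_indicator)
  finally show ?thesis
    unfolding D U by (simp add: mult.commute)
qed

section \<open>Existence of a stationary distribution\<close>

lemma measurable_length_states: "(\<lambda>\<eta>. v (length \<eta>)) \<in> borel_measurable states"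
  using measurable_compose_countable[of "\<lambda>n _. v n" states borel length]
  unfolding fifm_space_def by measurable

text \<open>Here the empty list is absorbing, so excursions from it and division by its rate make no
  sense. Its point mass is in balance because both sides are 0.\<close>

lemma stationary_exists_no_arrivals:
  assumes "total_arrival = 0"
  shows "stationary_distribution states rates (return states [])"
proof (rule stationary_distributionI)
  have space: "[] \<in> space states" by (simp add: space_states)
  show "prob_space (return states [])" using space by (rule prob_space_return)
  have q0: "total_rate rates [] = 0" using assms by (simp add: total_rate_fifm)
  show "(\<integral>\<^sup>+ x. ennreal (total_rate rates x) \<partial>return states []) < \<infinity>"
    using space by (subst nn_integral_return) (auto simp: q0)
  fix f :: "'a particle list \<Rightarrow> ennreal" assume f: "f \<in> borel_measurable states"
  have "emeasure (rates []) (space (rates [])) = 0"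
    using assms by (simp add: space_rates emeasure_rates_UNIV)
  then have "(\<integral>\<^sup>+ y. f y \<partial>rates []) = 0"
    by (intro nn_integral_0_iff_AE[THEN iffD2]) (use f in \<open>auto simp: borel_measurable_Q[OF space] intro!: AE_I[of _ _ "space (rates [])"]\<close>)
  then show "(\<integral>\<^sup>+ x. (\<integral>\<^sup>+ y. f y \<partial>rates x) \<partial>return states [])
      = (\<integral>\<^sup>+ x. ennreal (total_rate rates x) * f x \<partial>return states [])"
    using space f by (simp add: nn_integral_return measurable_nn_integral_Q q0)
qed simp

lemma stationary_exists_arrivals:
  assumes L: "0 < total_arrival"
  shows "\<exists>\<pi>. stationary_distribution states rates \<pi>"
proof -
  obtain v :: "nat \<Rightarrow> real" where v: "v 0 = 0" "\<And>n. 0 \<le> v n"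
    and drift: "\<And>n a b. 0 \<le> a \<Longrightarrow> 0 \<le> b \<Longrightarrow> a + b = total_arrival \<Longrightarrow>
       (real (Suc n) * mu + a) * v n + b * v (Suc (Suc n)) + (real (Suc n) * mu + total_arrival)
         \<le> (real (Suc n) * mu + total_arrival) * v (Suc n)"
    using queue_lyapunov_exists[OF mu L] by blast
  let ?V = "\<lambda>\<eta> :: 'a particle list. ennreal (v (length \<eta>))"
  have QV: "(\<integral>\<^sup>+ \<zeta>. ?V \<zeta> \<partial>rates \<eta>) = ennreal ((real (length \<eta>) * mu + measure lam2 (nbhds (set \<eta>))) * v (length \<eta> - 1)
      + measure lam2 (- nbhds (set \<eta>)) * v (Suc (length \<eta>)))" for \<eta>
    unfolding nn_integral_rates_length[where v="\<lambda>n. ennreal (v n)" and \<eta>=\<eta>]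
    using mu v(2)
    by (simp add: lam2.emeasure_eq_measure ennreal_mult[symmetric] ennreal_plus[symmetric] del: ennreal_plus)
  show ?thesis
  \<comment> \<open>The rate of the empty list is the smallest one, so \<open>total_arrival\<close>
    bounds all rates from below.\<close>
  proof (rule stationary_distribution_exists[of "[]" total_arrival ?V])
    show "?V \<in> borel_measurable states" by (rule measurable_length_states)
    show "total_arrival \<le> total_rate rates \<eta>" for \<eta> using mu by (simp add: total_rate_fifm)
    show "(\<integral>\<^sup>+ \<zeta>. ?V \<zeta> \<partial>rates []) < \<infinity>" unfolding QV by simp
    fix \<eta> :: "'a particle list" assume "\<eta> \<noteq> []"
    then obtain n where n: "length \<eta> = Suc n" by (cases \<eta>) auto
    have "measure lam2 (nbhds (set \<eta>)) + measure lam2 (- nbhds (set \<eta>)) = total_arrival"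
      using emeasure_nbhds_add_compl[of \<eta>] total_arrival_nonneg
      by (simp add: lam2.emeasure_eq_measure ennreal_plus[symmetric] del: ennreal_plus)
    \<comment> \<open>Here \<open>a\<close> and \<open>b\<close> are the masses of the joint
      neighbourhood of the list and of its complement.\<close>
    from drift[OF _ _ this, of n]
    show "(\<integral>\<^sup>+ \<zeta>. ?V \<zeta> \<partial>rates \<eta>) + ennreal (total_rate rates \<eta>) \<le> ennreal (total_rate rates \<eta>) * ?V \<eta>"
      unfolding QV total_rate_fifm n using mu v(2) L
      by (simp add: ennreal_plus[symmetric] ennreal_mult[symmetric] ennreal_leI del: ennreal_plus)
  qed (use L v(1) in \<open>auto simp: space_states Nil_sets\<close>)
qed

end

theorem mainTheorem7:
  fixes lam :: "'a::metric_space measure" and mu :: real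
  assumes "compact (UNIV :: 'a set)"
    and "radon_measure lam"
    and "mu > 0"
  shows "\<exists>!\<pi>. stationary_distribution fifm_space (fifm_rates lam mu) \<pi>"
proof -
  interpret fifm lam mu using assms by unfold_locales
  have "\<exists>\<pi>. stationary_distribution fifm_space (fifm_rates lam mu) \<pi>"
    using stationary_exists_no_arrivals stationary_exists_arrivals total_arrival_nonneg
    by (cases "total_arrival = 0") auto
  then show ?thesis
    using stationary_distribution_unique[OF Nil_sets jump_trans_Nil_pos] by blast
qed

end
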